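(* Let $p\ge5$ be prime, let $A$ be a finite étale cubic $\mathbb Z_p$-algebra with trace $\operatorname{Tr}_A:A\to\mathbb Z_p$, $\overline A=A/pA$, let $\eta\in A^\times$, $\gamma\in A$, $c\in\mathbb Z_p$. Let $P$ be the order of $\bar\eta$ in $\overline A^\times$, write $\eta^P=1+pU$ with $U\in A$, and put $\omega=\bar U\in\overline A$. For $a\in\{0,\dots,P-1\}$ let $x_a=\bar\gamma\bar\eta^a$ and \[ F_{a,c}(t)=\operatorname{Tr}_A\bigl(\gamma\eta^a(\eta^P)^t\bigr)-c,\qquad t\in\mathbb Z_p, \] and for $k\ge1$ let $Z_{p,c}(k)=\{n\bmod Pp^{k-1}:\operatorname{Tr}_A(\gamma\eta^n)\equiv c\pmod{p^k}\}$. Then \[ Z_{p,c}(1)=\{a\bmod P:\operatorname{Tr}_{\overline A/\mathbb F_p}(x_a)=\bar c\}. \] For every $a\in Z_{p,c}(1)$, $F_{a,c}(X)/p\in\mathbb Z_p\langle X\rangle$ and \[ \frac{F_{a,c}(t)}{p}\equiv\frac{\operatorname{Tr}_A(\gamma\eta^a)-c}{p}+t\operatorname{Tr}_{\overline A/\mathbb F_p}(x_a\omega)\pmod p. \] Consequently, if $d_a=\operatorname{Tr}_{\overline A/\mathbb F_p}(x_a\omega)\ne0$, there is a unique $\tau_{a,c}\in\mathbb Z_p$ with $F_{a,c}(\tau_{a,c})=0$, and $v_p(F_{a,c}(t))=1+v_p(t-\tau_{a,c})$ for all $t\in\mathbb Z_p$. If $d_a=0$, then the class lifts from modulo $p$ to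 modulo $p^2$ if and only if $(\operatorname{Tr}_A(\gamma\eta^a)-c)/p\equiv0\pmod p$. All higher lifts are obtained by the digit recursion: with $R(1)=\{0\}\subset\mathbb Z/p^0\mathbb Z$ and $R(k+1)=\{r+p^{k-1}j\bmod p^k: r\in R(k),\ j\in\{0,\dots,p-1\},\ F_{a,c}(r+p^{k-1}j)\equiv0\pmod{p^{k+1}}\}$, the set $R(k)$ is the set of residues $t\bmod p^{k-1}$ with $F_{a,c}(t)\equiv0\pmod{p^k}$.
   Context: For $t\in\mathbb Z_p$, $(\eta^P)^t$ is defined by the convergent binomial series $\sum_{m\ge0}\binom tm(\eta^P-1)^m$; thus $F_{a,c}$ is a restricted $p$-adic power series and $F_{a,c}(t)=\operatorname{Tr}_A(\gamma\eta^{a+Pt})-c$ for integers $t$. $\mathbb Z_p\langle X\rangle$ is the ring of restricted power series; $v_p(0)=+\infty$. *)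

theory Defs
  imports
    "Berlekamp_Zassenhaus.Finite_Field"
    "HOL-Computational_Algebra.Formal_Power_Series"
    "HOL-Library.Extended_Nat"
begin

section \<open>The ring of $p$-adic integers\<close>

text \<open>
  The prime is carried by a type \<open>'p\<close> of prime cardinality, as for the field \<open>'p mod_ring\<close>
  with \<open>p\<close> elements.  A \<open>p\<close>-adic integer is a compatible family of residues, the residue
  modulo \<open>p ^ n\<close> being represented in \<open>{0..<p ^ n}\<close> (the range condition is implied by the
  compatibility condition).
\<close>

typedef (overloaded) 'p padic_int =
  "{f :: nat \<Rightarrow> int. \<forall>n. f (Suc n) mod int CARD('p::prime_card) ^ n = f n}"
  morphisms padic_residue Abs_padic_int
  by (rule exI[of _ "\<lambda>_. 0"]) simp

setup_lifting type_definition_padic_int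

lemma padic_card_gt_1: "int CARD('p::prime_card) > 1"
  using prime_card_int[where 'a = 'p] prime_gt_1_int by blast

lemma mod_mod_power_Suc: "(x :: int) mod q ^ Suc n mod q ^ n = x mod q ^ n"
  by (simp add: mod_mod_cancel)

lemma padic_residue_Suc_mod:
  "padic_residue (x :: 'p::prime_card padic_int) (Suc n) mod int CARD('p) ^ n = padic_residue x n"
  using padic_residue[of x] by simp

lemma padic_residue_mod_le:
  "m \<le> n \<Longrightarrow>
    padic_residue (x :: 'p::prime_card padic_int) n mod int CARD('p) ^ m = padic_residue x m"
proof (induction n rule: dec_induct)
  case base
  show ?case
    by (metis mod_mod_trivial padic_residue_Suc_mod)
next
  case (step n)
  have "padic_residue x (Suc n) mod int CARD('p) ^ m
      = padic_residue x (Suc n) mod int CARD('p) ^ n mod int CARD('p) ^ m"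
    using step.hyps by (simp add: mod_mod_cancel le_imp_power_dvd)
  then show ?case
    using step.IH by (simp add: padic_residue_Suc_mod)
qed

lemma padic_residue_mod_self [simp]:
  "padic_residue (x :: 'p::prime_card padic_int) n mod int CARD('p) ^ n = padic_residue x n"
  by (rule padic_residue_mod_le) simp

lemma padic_int_eqI: "(\<And>n. padic_residue x n = padic_residue y n) \<Longrightarrow> x = y"
  by (simp add: padic_residue_inject[symmetric] ext)

instantiation padic_int :: (prime_card) comm_ring_1
begin

lift_definition zero_padic_int :: "'a padic_int" is "\<lambda>_. 0" by simp

lift_definition one_padic_int :: "'a padic_int" is "\<lambda>n. 1 mod int CARD('a) ^ n"
  by (simp only: mod_mod_power_Suc simp_thms)

lift_definition plus_padic_int :: "'a padic_int \<Rightarrow> 'a padic_int \<Rightarrow> 'a padic_int" is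
  "\<lambda>f g n. (f n + g n) mod int CARD('a) ^ n"
  by (metis mod_add_eq mod_mod_power_Suc)

lift_definition minus_padic_int :: "'a padic_int \<Rightarrow> 'a padic_int \<Rightarrow> 'a padic_int" is
  "\<lambda>f g n. (f n - g n) mod int CARD('a) ^ n"
  by (metis mod_diff_eq mod_mod_power_Suc)

lift_definition uminus_padic_int :: "'a padic_int \<Rightarrow> 'a padic_int" is
  "\<lambda>f n. (- f n) mod int CARD('a) ^ n"
  by (metis mod_minus_eq mod_mod_power_Suc)

lift_definition times_padic_int :: "'a padic_int \<Rightarrow> 'a padic_int \<Rightarrow> 'a padic_int" is
  "\<lambda>f g n. (f n * g n) mod int CARD('a) ^ n"
  by (metis mod_mult_eq mod_mod_power_Suc)

instance
proof
  fix a b c :: "'a padic_int"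
  show "a * b * c = a * (b * c)"
    by (rule padic_int_eqI) (simp add: times_padic_int.rep_eq mod_simps mult.assoc)
  show "a * b = b * a"
    by (rule padic_int_eqI) (simp add: times_padic_int.rep_eq mult.commute)
  show "1 * a = a"
    by (rule padic_int_eqI) (simp add: times_padic_int.rep_eq one_padic_int.rep_eq mod_simps)
  show "a + b + c = a + (b + c)"
    by (rule padic_int_eqI) (simp add: plus_padic_int.rep_eq mod_simps add.assoc)
  show "a + b = b + a"
    by (rule padic_int_eqI) (simp add: plus_padic_int.rep_eq add.commute)
  show "0 + a = a"
    by (rule padic_int_eqI) (simp add: plus_padic_int.rep_eq zero_padic_int.rep_eq)
  show "- a + a = 0"
    by (rule padic_int_eqI)
      (simp add: plus_padic_int.rep_eq zero_padic_int.rep_eq uminus_padic_int.rep_eq mod_simps)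
  show "a - b = a + - b"
    by (rule padic_int_eqI)
      (simp add: plus_padic_int.rep_eq minus_padic_int.rep_eq uminus_padic_int.rep_eq mod_simps)
  show "(a + b) * c = a * c + b * c"
    by (rule padic_int_eqI)
      (simp add: plus_padic_int.rep_eq times_padic_int.rep_eq mod_simps algebra_simps)
  have "padic_residue (0 :: 'a padic_int) 1 \<noteq> padic_residue (1 :: 'a padic_int) 1"
    using padic_card_gt_1[where 'p = 'a]
    by (simp add: zero_padic_int.rep_eq one_padic_int.rep_eq)
  then show "(0 :: 'a padic_int) \<noteq> 1"
    by metis
qed

end

lemma padic_residue_of_nat:
  "padic_residue (of_nat m :: 'p::prime_card padic_int) n = int m mod int CARD('p) ^ n"
  by (induction m)
    (simp_all add: zero_padic_int.rep_eq plus_padic_int.rep_eq one_padic_int.rep_eq mod_simps)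

instance padic_int :: (prime_card) ring_char_0
proof
  show "inj (of_nat :: nat \<Rightarrow> 'a padic_int)"
  proof (rule injI)
    fix m n :: nat
    assume eq: "(of_nat m :: 'a padic_int) = of_nat n"
    define k where "k = m + n"
    have gt: "int k < int CARD('a) ^ k"
      using power_gt_expt[of "CARD('a)" k] prime_gt_1_nat[OF prime_card[where 'a = 'a]]
      by (metis One_nat_def of_nat_less_iff of_nat_power)
    have "int m mod int CARD('a) ^ k = int n mod int CARD('a) ^ k"
      using eq by (metis padic_residue_of_nat)
    moreover have "int m < int CARD('a) ^ k" "int n < int CARD('a) ^ k"
      using gt unfolding k_def by linarith+
    ultimately show "m = n"
      by (simp add: mod_pos_pos_trivial)
  qed
qed

instance padic_int :: (prime_card) idom
proof
  fix a b :: "'a padic_int"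
  assume "a \<noteq> 0" "b \<noteq> 0"
  then obtain m n where m: "padic_residue a m \<noteq> 0" and n: "padic_residue b n \<noteq> 0"
    by (metis padic_int_eqI zero_padic_int.rep_eq)
  let ?p = "int CARD('a)"
  define x y where "x = padic_residue a (m + n)" and "y = padic_residue b (m + n)"
  have x: "\<not> ?p ^ m dvd x" and y: "\<not> ?p ^ n dvd y"
    using m n padic_residue_mod_le[of m "m + n" a] padic_residue_mod_le[of n "m + n" b]
    by (auto simp: x_def y_def dvd_eq_mod_eq_0)
  have p: "prime ?p"
    by (rule prime_card_int)
  have nz: "x \<noteq> 0" "y \<noteq> 0"
    using x y by auto
  have "multiplicity ?p x < m" "multiplicity ?p y < n"
    using x y by (meson multiplicity_dvd' not_less)+
  then have "multiplicity ?p (x * y) < m + n"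
    using p nz by (simp add: prime_elem_multiplicity_mult_distrib)
  moreover have "\<not> is_unit ?p"
    using p not_prime_unit by blast
  ultimately have "\<not> ?p ^ (m + n) dvd x * y"
    using nz by (simp add: power_dvd_iff_le_multiplicity)
  then have "padic_residue (a * b) (m + n) \<noteq> 0"
    by (simp add: times_padic_int.rep_eq x_def y_def dvd_eq_mod_eq_0)
  then show "a * b \<noteq> 0"
    by (metis zero_padic_int.rep_eq)
qed

text \<open>Exact division: \<open>x div y\<close> is the quotient if \<open>y \<noteq> 0\<close> divides \<open>x\<close>.\<close>

instantiation padic_int :: (prime_card) idom_divide
begin

definition divide_padic_int :: "'a padic_int \<Rightarrow> 'a padic_int \<Rightarrow> 'a padic_int" where
  "divide_padic_int x y = (if y \<noteq> 0 \<and> y dvd x then THE z. x = z * y else 0)"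

instance
  by standard (auto simp: divide_padic_int_def)

end

text \<open>
  The defining formula of \<open>gbinomial\<close>, which is itself not used because its type is constrained
  to fields.
\<close>

definition padic_binomial :: "'p::prime_card padic_int \<Rightarrow> nat \<Rightarrow> 'p padic_int" where
  "padic_binomial t m = (\<Prod>i=0..<m. t - of_nat i) div fact m"

definition padic_to_Fp :: "'p::prime_card padic_int \<Rightarrow> 'p mod_ring" where
  "padic_to_Fp t = of_int_mod_ring (padic_residue t 1)"

definition padic_val :: "'p::prime_card padic_int \<Rightarrow> enat" where
  "padic_val x = (if x = 0 then \<infinity> else enat (Max {n. of_nat CARD('p) ^ n dvd x}))"

definition padic_sums :: "nat \<Rightarrow> (nat \<Rightarrow> 'a::comm_ring_1) \<Rightarrow> 'a \<Rightarrow> bool" where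
  "padic_sums p f s \<longleftrightarrow> (\<forall>k. \<exists>N. \<forall>n\<ge>N. of_nat p ^ k dvd (\<Sum>m<n. f m) - s)"

definition restricted_series :: "'p::prime_card padic_int fps set" where
  "restricted_series = {f. \<forall>k. \<exists>N. \<forall>n\<ge>N. of_nat CARD('p) ^ k dvd fps_nth f n}"

definition represents_function ::
    "'p::prime_card padic_int fps \<Rightarrow> ('p padic_int \<Rightarrow> 'p padic_int) \<Rightarrow> bool" where
  "represents_function f F \<longleftrightarrow> (\<forall>t. padic_sums CARD('p) (\<lambda>n. fps_nth f n * t ^ n) (F t))"


section \<open>Algebras, traces, finite \'etale algebras\<close>

text \<open>The class of the algebra does not demand \<open>0 \<noteq> 1\<close>, so that quotient rings are covered.\<close>

locale comm_algebra = Modules.module scale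
  for scale :: "'r::comm_ring_1 \<Rightarrow> 'a::{comm_ring,comm_monoid_mult} \<Rightarrow> 'a" +
  assumes scale_mult_left: "scale r (x * y) = scale r x * y"

definition is_module_basis :: "('r::comm_ring_1 \<Rightarrow> 'a::ab_group_add \<Rightarrow> 'a) \<Rightarrow> 'a set \<Rightarrow> bool" where
  "is_module_basis scale B \<longleftrightarrow>
     finite B \<and> \<not> Modules.module.dependent scale B \<and> Modules.module.span scale B = UNIV"

text \<open>The trace of multiplication by \<open>x\<close>, computed in an arbitrary finite basis.\<close>

definition algebra_trace ::
    "('r::comm_ring_1 \<Rightarrow> 'a::{comm_ring,comm_monoid_mult} \<Rightarrow> 'a) \<Rightarrow> 'a \<Rightarrow> 'r" where
  "algebra_trace scale x =
     (let B = (SOME B. is_module_basis scale B)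
      in \<Sum>b\<in>B. Modules.module.representation scale B (x * b) b)"

text \<open>
  Finite \'etale of constant degree \<open>n\<close> over a local base ring, in the sense of Lenstra's
  ``Galois theory for schemes'': free of rank \<open>n\<close> as a module (over a local ring, finite
  projective modules are free) and separable, i.e. the map sending \<open>x\<close> to the linear form
  \<open>y \<mapsto> Tr (x * y)\<close> is a bijection from the algebra to its dual module.
\<close>

definition finite_etale_algebra ::
    "('r::comm_ring_1 \<Rightarrow> 'a::{comm_ring,comm_monoid_mult} \<Rightarrow> 'a) \<Rightarrow> nat \<Rightarrow> bool" where
  "finite_etale_algebra scale n \<longleftrightarrow>
     comm_algebra scale \<and>
     (\<exists>B. is_module_basis scale B \<and> card B = n) \<and>
     (\<forall>\<phi>. Modules.module_hom scale (*) \<phi> \<longrightarrow> (\<exists>!x. \<forall>y. \<phi> y = algebra_trace scale (x * y)))"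


section \<open>The quotient $A/pA$ as an algebra over the prime field\<close>

quotient_type (overloaded) ('a, 'p) mod_p =
  "'a::comm_ring_1" / "\<lambda>x y. of_nat CARD('p::prime_card) dvd x - y"
  morphisms rep_mod_p to_mod_p
proof (rule equivpI)
  show "reflp (\<lambda>x y :: 'a. of_nat CARD('p) dvd x - y)"
    by (simp add: reflp_def)
  show "symp (\<lambda>x y :: 'a. of_nat CARD('p) dvd x - y)"
    unfolding symp_def by (metis dvd_minus_iff minus_diff_eq)
  show "transp (\<lambda>x y :: 'a. of_nat CARD('p) dvd x - y)"
    unfolding transp_def by (metis diff_add_cancel add_diff_eq dvd_add)
qed

instantiation mod_p :: (comm_ring_1, prime_card) "{comm_ring,comm_monoid_mult}"
begin

lift_definition zero_mod_p :: "('a, 'b) mod_p" is 0 .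
lift_definition one_mod_p :: "('a, 'b) mod_p" is 1 .

lift_definition plus_mod_p :: "('a, 'b) mod_p \<Rightarrow> ('a, 'b) mod_p \<Rightarrow> ('a, 'b) mod_p" is "(+)"
  by (metis add_diff_add dvd_add)

lift_definition uminus_mod_p :: "('a, 'b) mod_p \<Rightarrow> ('a, 'b) mod_p" is uminus
  by (metis dvd_minus_iff minus_diff_minus)

lift_definition minus_mod_p :: "('a, 'b) mod_p \<Rightarrow> ('a, 'b) mod_p \<Rightarrow> ('a, 'b) mod_p" is "(-)"
proof -
  fix x y u v :: 'a
  assume "of_nat CARD('b) dvd x - y" "of_nat CARD('b) dvd u - v"
  then have "of_nat CARD('b) dvd (x - y) - (u - v)"
    by (rule dvd_diff)
  then show "of_nat CARD('b) dvd (x - u) - (y - v)"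
    by (simp add: algebra_simps)
qed

lift_definition times_mod_p :: "('a, 'b) mod_p \<Rightarrow> ('a, 'b) mod_p \<Rightarrow> ('a, 'b) mod_p" is "(*)"
proof -
  fix x y u v :: 'a
  assume "of_nat CARD('b) dvd x - y" "of_nat CARD('b) dvd u - v"
  then have "of_nat CARD('b) dvd (x - y) * u + y * (u - v)"
    by (intro dvd_add dvd_mult dvd_mult2)
  then show "of_nat CARD('b) dvd x * u - y * v"
    by (simp add: algebra_simps)
qed

instance
  by standard (transfer; simp add: algebra_simps)+

end

text \<open>
  A ring has at most one structure of algebra over the prime field, so the structure induced
  on \<open>A/pA\<close> from a \<open>\<int>\<^sub>p\<close>-algebra structure on \<open>A\<close> is the following one.
\<close>

lift_definition Fp_scale ::
    "'p::prime_card mod_ring \<Rightarrow> ('a::comm_ring_1, 'p) mod_p \<Rightarrow> ('a, 'p) mod_p" is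
  "\<lambda>c x. of_int (to_int_mod_ring c) * x"
  by (metis dvd_mult right_diff_distrib)


section \<open>Powers, zeros of trace sequences, digit recursion\<close>

text \<open>The order is \<open>0\<close> if no positive power is \<open>1\<close>.\<close>

definition mult_order :: "'a::monoid_mult \<Rightarrow> nat" where
  "mult_order x = (if \<exists>n>0. x ^ n = 1 then LEAST n. 0 < n \<and> x ^ n = 1 else 0)"

text \<open>Integer powers of a unit.\<close>

definition unit_powi :: "'a::comm_monoid_mult \<Rightarrow> int \<Rightarrow> 'a" where
  "unit_powi x n = (if 0 \<le> n then x ^ nat n else (THE y. x * y = 1) ^ nat (- n))"

definition binomial_power ::
    "('p::prime_card padic_int \<Rightarrow> 'a::comm_ring_1 \<Rightarrow> 'a) \<Rightarrow> 'a \<Rightarrow> 'p padic_int \<Rightarrow> 'a" where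
  "binomial_power scale u t =
     (THE s. padic_sums CARD('p) (\<lambda>m. scale (padic_binomial t m) ((u - 1) ^ m)) s)"

text \<open>Residue classes modulo \<open>N\<close> are represented by their elements in \<open>{0..<N}\<close>.\<close>

definition trace_zeros ::
    "('p::prime_card padic_int \<Rightarrow> 'a::comm_ring_1 \<Rightarrow> 'a) \<Rightarrow> 'a \<Rightarrow> 'a \<Rightarrow> 'p padic_int \<Rightarrow>
      nat \<Rightarrow> nat \<Rightarrow> int set" where
  "trace_zeros scale \<gamma> \<eta> c P k =
     {n mod (int P * int CARD('p) ^ (k - 1)) | n :: int.
        of_nat CARD('p) ^ k dvd algebra_trace scale (\<gamma> * unit_powi \<eta> n) - c}"

text \<open>The recursion starts at index \<open>1\<close>; the value at \<open>0\<close> is irrelevant.\<close>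

fun digit_recursion :: "('p::prime_card padic_int \<Rightarrow> 'p padic_int) \<Rightarrow> nat \<Rightarrow> int set" where
  "digit_recursion F 0 = {}"
| "digit_recursion F (Suc 0) = {0}"
| "digit_recursion F (Suc (Suc k)) =
     {(r + int CARD('p) ^ k * j) mod int CARD('p) ^ Suc k | r j.
        r \<in> digit_recursion F (Suc k) \<and> j \<in> {0..<int CARD('p)} \<and>
        of_nat CARD('p) ^ Suc (Suc k) dvd F (of_int (r + int CARD('p) ^ k * j))}"

end

theory Submission
  imports Defs
begin

text \<open>
  With \<open>\<eta> ^ P = 1 + p U\<close>, the binomial series expands \<open>F\<close> as
  \<open>\<Sum>m. (p ^ m / m!) Tr (\<gamma> \<eta> ^ a U ^ m) t (t - 1) \<dots> (t - m + 1) - c\<close>.  For \<open>p \<ge> 5\<close> the factorial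
  \<open>m!\<close> divides \<open>p ^ (m div 4)\<close> in the \<open>p\<close>-adic integers, so the coefficients \<open>p ^ m / m!\<close> tend to
  \<open>0\<close> and are divisible by \<open>p\<^sup>2\<close> for \<open>m \<ge> 2\<close>.  Rearranging by powers of \<open>t\<close> gives a restricted
  power series congruent to an affine one modulo \<open>p\<^sup>2\<close>, hence
  \<open>F t - F s = p (t - s) (\<delta> + p h)\<close> with \<open>\<delta> = Tr (\<gamma> \<eta> ^ a U)\<close>.  Everything about zeros, valuations
  and digits follows from this single identity.
\<close>

section \<open>Divisibility and convergence in the $p$-adic integers\<close>

text \<open>Convergence is expressed throughout by divisibility of errors by \<open>p ^ k\<close>.
  The delicate point is that \<open>F t - F s\<close> must be known modulo
  \<open>p ^ 2 * (t - s)\<close>, not merely modulo \<open>p ^ 2\<close>: the factor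
  \<open>t - s\<close> makes \<open>F / p\<close> an isometry when \<delta> is a unit, instead of
  just a bijection modulo \<open>p\<close>. Infinite sums can be handled modulo such an element
  because every nonzero p-adic integer divides a power of \<open>p\<close>. The bound
  \<open>m div 4\<close> reflects v_p(m!) \<le> m / (p - 1) \<le> m / 4. The extra factor
  \<open>p\<close> in \<open>F\<close> also explains the index shift in the digit recursion:
  \<open>t\<close> modulo \<open>p ^ (k - 1)\<close> decides whether \<open>F t\<close> vanishes
  modulo \<open>p ^ k\<close>.\<close>

lemma padic_power_dvd_iff:
  "of_nat CARD('p) ^ k dvd (x :: 'p::prime_card padic_int) \<longleftrightarrow> padic_residue x k = 0"
proof
  let ?q = "int CARD('p)"
  have q: "?q ^ n > 0" for n
    using padic_card_gt_1[where 'p = 'p] by simp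
  have pow: "(of_nat CARD('p) ^ k :: 'p padic_int) = of_nat (CARD('p) ^ k)"
    by simp
  show "padic_residue x k = 0" if "of_nat CARD('p) ^ k dvd x"
  proof -
    from that obtain y where "x = of_nat (CARD('p) ^ k) * y"
      unfolding pow by (elim dvdE)
    then show ?thesis
      by (simp only: times_padic_int.rep_eq padic_residue_of_nat) simp
  qed
  show "of_nat CARD('p) ^ k dvd x" if 0: "padic_residue x k = 0"
  proof -
    \<comment> \<open>Dividing by \<open>p ^ k\<close> costs k digits, so the quotient modulo
      \<open>p ^ n\<close> is read off at level \<open>n + k\<close>.\<close>
    define g where "g n = padic_residue x (n + k) div ?q ^ k" for n
    have "g (Suc n) mod ?q ^ n = g n" for n
    proof -
      have "g (Suc n) mod ?q ^ n = padic_residue x (Suc (n + k)) mod (?q ^ k * ?q ^ n) div ?q ^ k"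
        unfolding g_def using q[of k] q[of n]
        by (simp add: zmod_zmult2_eq)
      also have "\<dots> = g n"
        unfolding g_def by (simp add: padic_residue_Suc_mod flip: power_add add.commute[of n k])
      finally show ?thesis .
    qed
    then have rep: "padic_residue (Abs_padic_int g :: 'p padic_int) = g"
      by (intro Abs_padic_int_inverse) simp
    have "x = of_nat (CARD('p) ^ k) * Abs_padic_int g"
    proof (rule padic_int_eqI)
      fix n
      have "padic_residue x (n + k) mod ?q ^ k = 0"
        using padic_residue_mod_le[of k "n + k" x] 0 by simp
      then have "?q ^ k * g n = padic_residue x (n + k)"
        unfolding g_def by (metis add.right_neutral div_mult_mod_eq mult.commute)
      then show "padic_residue x n
          = padic_residue (of_nat (CARD('p) ^ k) * Abs_padic_int g :: 'p padic_int) n"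
        using padic_residue_mod_le[of n "n + k" x]
        unfolding times_padic_int.rep_eq padic_residue_of_nat rep by (simp add: mod_simps)
    qed
    then show ?thesis
      unfolding pow by (rule dvdI)
  qed
qed

lemma padic_residue_eq_iff:
  "padic_residue x k = padic_residue y k \<longleftrightarrow> of_nat CARD('p) ^ k dvd (x - y :: 'p::prime_card padic_int)"
proof -
  have "padic_residue (x - y) k = 0 \<longleftrightarrow>
      padic_residue x k mod int CARD('p) ^ k = padic_residue y k mod int CARD('p) ^ k"
    by (simp add: minus_padic_int.rep_eq mod_eq_dvd_iff dvd_eq_mod_eq_0 del: padic_residue_mod_self)
  then show ?thesis
    by (simp add: padic_power_dvd_iff)
qed

lemma padic_residue_of_int:
  "padic_residue (of_int m :: 'p::prime_card padic_int) n = m mod int CARD('p) ^ n"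
proof (cases m)
  case (neg k)
  have "padic_residue (- of_nat (Suc k) :: 'p padic_int) n = - int (Suc k) mod int CARD('p) ^ n"
    by (simp only: uminus_padic_int.rep_eq padic_residue_of_nat mod_minus_eq)
  then show ?thesis
    using neg by simp
qed (simp add: padic_residue_of_nat)

lemma padic_residue_bounds:
  "padic_residue (x :: 'p::prime_card padic_int) n \<in> {0..<int CARD('p) ^ n}"
proof -
  have "int CARD('p) ^ n > 0"
    using padic_card_gt_1[where 'p = 'p] by simp
  then show ?thesis
    using padic_residue_mod_self[of x n] by (metis atLeastLessThan_iff pos_mod_bound pos_mod_sign)
qed

lemma padic_dvd_diff_residue:
  "of_nat CARD('p) ^ k dvd x - of_int (padic_residue (x :: 'p::prime_card padic_int) k)"
  by (simp add: padic_residue_of_int flip: padic_residue_eq_iff)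

lemma padic_eq_0I:
  assumes "\<And>k. of_nat CARD('p) ^ k dvd (x :: 'p::prime_card padic_int)"
  shows "x = 0"
  using assms by (intro padic_int_eqI) (simp add: padic_power_dvd_iff zero_padic_int.rep_eq)

lemma padic_p_nonzero: "(of_nat CARD('p) :: 'p::prime_card padic_int) \<noteq> 0"
  by simp

lemma padic_power_dvd_of_int_iff:
  "of_nat CARD('p) ^ k dvd (of_int m :: 'p::prime_card padic_int) \<longleftrightarrow> int CARD('p) ^ k dvd m"
  by (simp add: padic_power_dvd_iff padic_residue_of_int dvd_eq_mod_eq_0)

text \<open>Residues of \<open>x\<close> are invertible at every level. Inverses modulo
  \<open>p ^ n\<close> are unique, so arbitrarily chosen ones fit together after reduction.\<close>

lemma padic_unitI:
  fixes x :: "'p::prime_card padic_int"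
  assumes "\<not> of_nat CARD('p) dvd x"
  shows "x dvd 1"
proof -
  let ?q = "int CARD('p)"
  have cop: "coprime (padic_residue x n) (?q ^ n)" for n
  proof (cases n)
    case (Suc m)
    have "padic_residue x 1 \<noteq> 0"
      using assms padic_power_dvd_iff[of 1 x] by simp
    then have "padic_residue x n mod ?q \<noteq> 0"
      using padic_residue_mod_le[of 1 n x] Suc by simp
    then have "coprime ?q (padic_residue x n)"
      using prime_card_int[where 'a = 'p] by (simp add: dvd_eq_mod_eq_0 prime_imp_coprime)
    then show ?thesis
      by (simp add: coprime_commute)
  qed simp
  have "\<exists>y. (padic_residue x n * y) mod ?q ^ n = 1 mod ?q ^ n" for n
    using coprime_iff_invertible_int[of "padic_residue x n" "?q ^ n"] cop[of n]
    by (auto simp: cong_def)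
  then obtain y where y: "\<And>n. (padic_residue x n * y n) mod ?q ^ n = 1 mod ?q ^ n"
    by metis
  define g where "g n = y n mod ?q ^ n" for n
  have "g (Suc n) mod ?q ^ n = g n" for n
  proof -
    have "(padic_residue x n * y (Suc n)) mod ?q ^ n
        = (padic_residue x (Suc n) * y (Suc n)) mod ?q ^ n"
      by (metis mod_mult_left_eq padic_residue_Suc_mod)
    also have "\<dots> = 1 mod ?q ^ n"
      using y[of "Suc n"] by (metis mod_mod_power_Suc)
    finally have "[padic_residue x n * y (Suc n) = padic_residue x n * y n] (mod ?q ^ n)"
      using y[of n] by (simp add: cong_def)
    then have "[y (Suc n) = y n] (mod ?q ^ n)"
      using cop[of n] by (simp add: cong_mult_lcancel)
    then show ?thesis
      unfolding g_def by (simp only: mod_mod_power_Suc cong_def)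
  qed
  then have rep: "padic_residue (Abs_padic_int g :: 'p padic_int) = g"
    by (intro Abs_padic_int_inverse) simp
  have "1 = x * Abs_padic_int g"
    by (rule padic_int_eqI)
      (simp add: times_padic_int.rep_eq one_padic_int.rep_eq rep g_def y mod_simps)
  then show ?thesis
    by (rule dvdI)
qed

lemma padic_not_p_dvd_1: "\<not> of_nat CARD('p) dvd (1 :: 'p::prime_card padic_int)"
  using padic_power_dvd_iff[of 1 "1 :: 'p padic_int"] padic_card_gt_1[where 'p = 'p]
  by (simp add: one_padic_int.rep_eq)

text \<open>A nonzero element is a power of \<open>p\<close> times a unit. This converts a modulus
  such as \<open>m!\<close> or \<open>D * (t - s)\<close> into a power of \<open>p\<close>, for
  which approximations are available.\<close>

lemma padic_dvd_p_power:
  fixes x :: "'p::prime_card padic_int"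
  assumes "x \<noteq> 0"
  obtains k where "x dvd of_nat CARD('p) ^ k"
proof -
  let ?p = "of_nat CARD('p) :: 'p padic_int"
  obtain n where n: "\<not> ?p ^ n dvd x"
    using assms padic_eq_0I by blast
  define m where "m = (LEAST n. \<not> ?p ^ n dvd x)"
  have m: "\<not> ?p ^ m dvd x"
    unfolding m_def using n by (rule LeastI)
  then obtain k where k: "m = Suc k"
    by (cases m) auto
  have "?p ^ k dvd x"
    using not_less_Least[of k "\<lambda>n. \<not> ?p ^ n dvd x"] k unfolding m_def by auto
  then obtain u where u: "x = ?p ^ k * u" ..
  have "\<not> ?p dvd u"
    using m unfolding k u power_Suc2 by (simp add: mult_dvd_mono)
  then have "u dvd 1"
    by (rule padic_unitI)
  then have "x dvd ?p ^ k"
    unfolding u using mult_dvd_mono[of "?p ^ k" "?p ^ k" u 1] by simp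
  then show thesis
    by (rule that)
qed

text \<open>Completeness with an explicit rate: the limit has the diagonal residues
  \<open>X k\<close> modulo \<open>p ^ k\<close>.\<close>

lemma padic_convergent:
  fixes X :: "nat \<Rightarrow> 'p::prime_card padic_int"
  assumes "\<And>k. of_nat CARD('p) ^ k dvd X (Suc k) - X k"
  obtains L where "\<And>k. of_nat CARD('p) ^ k dvd X k - L"
proof -
  define g where "g k = padic_residue (X k) k" for k
  have "g (Suc k) mod int CARD('p) ^ k = g k" for k
    unfolding g_def padic_residue_Suc_mod using assms[of k] by (simp only: padic_residue_eq_iff)
  then have "padic_residue (Abs_padic_int g :: 'p padic_int) = g"
    by (intro Abs_padic_int_inverse) simp
  then have "of_nat CARD('p) ^ k dvd X k - Abs_padic_int g" for k
    by (simp add: g_def flip: padic_residue_eq_iff)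
  then show thesis
    by (rule that)
qed

section \<open>Convergent series and valuations\<close>

lemma dvd_partial_sum_diff:
  fixes f :: "nat \<Rightarrow> 'a::comm_ring_1"
  assumes "\<And>i. N \<le> i \<Longrightarrow> D dvd f i" "N \<le> n"
  shows "D dvd (\<Sum>m<n. f m) - (\<Sum>m<N. f m)"
  using assms(2)
proof (induction n rule: dec_induct)
  case (step n)
  have "D dvd ((\<Sum>m<n. f m) - (\<Sum>m<N. f m)) + f n"
    using step assms(1) by (intro dvd_add) auto
  then show ?case
    by (simp add: algebra_simps)
qed simp

text \<open>Replaces the unspecified threshold in \<open>padic_sums\<close> by any index beyond
  which the terms are small; by the ultrametric inequality the whole tail is then small.\<close>

lemma padic_sums_tail:
  fixes f :: "nat \<Rightarrow> 'a::comm_ring_1"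
  assumes "padic_sums p f s" "\<And>i. N \<le> i \<Longrightarrow> of_nat p ^ k dvd f i"
  shows "of_nat p ^ k dvd (\<Sum>m<N. f m) - s"
proof -
  obtain M where M: "\<And>n. n \<ge> M \<Longrightarrow> of_nat p ^ k dvd (\<Sum>m<n. f m) - s"
    using assms(1) unfolding padic_sums_def by blast
  have "of_nat p ^ k dvd ((\<Sum>m<max M N. f m) - s) - ((\<Sum>m<max M N. f m) - (\<Sum>m<N. f m))"
    by (intro dvd_diff M dvd_partial_sum_diff assms(2)) auto
  then show ?thesis
    by simp
qed

lemma padic_null_series_sums:
  fixes f :: "nat \<Rightarrow> 'p::prime_card padic_int"
  assumes "\<And>k. \<exists>N. \<forall>n\<ge>N. of_nat CARD('p) ^ k dvd f n"
  obtains s where "padic_sums CARD('p) f s"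
proof -
  let ?p = "of_nat CARD('p) :: 'p padic_int"
  from assms obtain N where N: "\<And>k n. n \<ge> N k \<Longrightarrow> ?p ^ k dvd f n"
    by metis
  define X where "X k = (\<Sum>m<N k. f m)" for k
  have "?p ^ k dvd X (Suc k) - X k" for k
  proof -
    \<comment> \<open>The thresholds \<open>N k\<close> need not increase with k, so consecutive
      truncations are compared through a common later one.\<close>
    let ?M = "max (N k) (N (Suc k))"
    have "?p ^ k dvd f n" if "n \<ge> N (Suc k)" for n
      using N[OF that] by (metis dvd_trans le_imp_power_dvd lessI less_imp_le)
    then have "?p ^ k dvd (\<Sum>m<?M. f m) - X (Suc k)"
      unfolding X_def by (intro dvd_partial_sum_diff) auto
    moreover have "?p ^ k dvd (\<Sum>m<?M. f m) - X k"
      unfolding X_def by (intro dvd_partial_sum_diff N) auto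
    ultimately have "?p ^ k dvd ((\<Sum>m<?M. f m) - X k) - ((\<Sum>m<?M. f m) - X (Suc k))"
      by (metis dvd_diff)
    then show ?thesis
      by simp
  qed
  then obtain L where L: "\<And>k. ?p ^ k dvd X k - L"
    by (rule padic_convergent) blast
  have "?p ^ k dvd (\<Sum>m<n. f m) - L" if "n \<ge> N k" for k n
  proof -
    have "?p ^ k dvd ((\<Sum>m<n. f m) - X k) + (X k - L)"
      unfolding X_def by (intro dvd_add dvd_partial_sum_diff N that L[unfolded X_def])
    then show ?thesis
      by simp
  qed
  then have "padic_sums CARD('p) f L"
    unfolding padic_sums_def by blast
  then show thesis
    by (rule that)
qed

text \<open>A nonzero element is not divisible by all powers of \<open>p\<close>, so the
  \<open>Max\<close> in the valuation is over a finite nonempty set. Valuations are later handled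
  only through these lower bounds, which also cover infinity.\<close>

lemma padic_val_ge_iff:
  fixes x :: "'p::prime_card padic_int"
  shows "enat k \<le> padic_val x \<longleftrightarrow> of_nat CARD('p) ^ k dvd x"
proof (cases "x = 0")
  case False
  let ?S = "{n. of_nat CARD('p) ^ n dvd x}"
  obtain N where N: "\<not> of_nat CARD('p) ^ N dvd x"
    using False padic_eq_0I by blast
  have "?S \<subseteq> {..<N}"
    using N by (metis (no_types, lifting) dvd_trans le_imp_power_dvd lessThan_iff mem_Collect_eq
        not_less subsetI)
  then have fin: "finite ?S"
    by (rule finite_subset) simp
  have "of_nat CARD('p) ^ Max ?S dvd x"
  proof -
    have "0 \<in> ?S"
      by simp
    then have "Max ?S \<in> ?S"
      using fin Max_in by blast
    then show ?thesis
      by simp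
  qed
  then have "of_nat CARD('p) ^ k dvd x" if "k \<le> Max ?S"
    using that by (meson dvd_trans le_imp_power_dvd)
  moreover have "k \<le> Max ?S" if "of_nat CARD('p) ^ k dvd x"
    using Max_ge[OF fin] that by simp
  ultimately show ?thesis
    using False by (auto simp: padic_val_def)
qed (simp add: padic_val_def)

section \<open>The residue map to the prime field\<close>

lemma padic_to_Fp_eq_iff:
  "padic_to_Fp x = padic_to_Fp y \<longleftrightarrow> of_nat CARD('p) dvd (x - y :: 'p::prime_card padic_int)"
proof -
  have "padic_to_Fp x = padic_to_Fp y \<longleftrightarrow> padic_residue x 1 = padic_residue y 1"
    unfolding padic_to_Fp_def
    by (metis padic_residue_bounds power_one_right to_int_mod_ring_of_int_mod_ring atLeastLessThan_iff)
  then show ?thesis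
    by (simp add: padic_residue_eq_iff)
qed

lemma of_int_mod_ring_mod_card:
  "of_int_mod_ring (x mod int CARD('p)) = (of_int_mod_ring x :: 'p::prime_card mod_ring)"
  by (transfer) simp

lemma padic_to_Fp_0 [simp]: "padic_to_Fp (0 :: 'p::prime_card padic_int) = 0"
  by (simp add: padic_to_Fp_def zero_padic_int.rep_eq)

lemma padic_to_Fp_add:
  "padic_to_Fp (x + y) = padic_to_Fp x + padic_to_Fp (y :: 'p::prime_card padic_int)"
  by (simp add: padic_to_Fp_def plus_padic_int.rep_eq of_int_mod_ring_mod_card)
    (transfer, simp add: mod_simps)

lemma padic_to_Fp_mult:
  "padic_to_Fp (x * y) = padic_to_Fp x * padic_to_Fp (y :: 'p::prime_card padic_int)"
  by (simp add: padic_to_Fp_def times_padic_int.rep_eq of_int_mod_ring_mod_card)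
    (transfer, simp add: mod_simps)

lemma padic_to_Fp_sum:
  "padic_to_Fp (\<Sum>i\<in>I. f i) = (\<Sum>i\<in>I. padic_to_Fp (f i :: 'p::prime_card padic_int))"
  by (induction I rule: infinite_finite_induct) (simp_all add: padic_to_Fp_add)

lemma padic_to_Fp_eq_0_iff:
  "padic_to_Fp x = 0 \<longleftrightarrow> of_nat CARD('p) dvd (x :: 'p::prime_card padic_int)"
  using padic_to_Fp_eq_iff[of x 0] by simp


section \<open>Binomial series as power series\<close>

lemma padic_of_nat_unitI:
  assumes "\<not> CARD('p) dvd n"
  shows "(of_nat n :: 'p::prime_card padic_int) dvd 1"
  using assms padic_power_dvd_of_int_iff[of 1 "int n", where 'p = 'p]
  by (intro padic_unitI) simp

text \<open>Among the factors of \<open>m!\<close>, the multiples of \<open>p\<close> contribute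
  exactly the right-hand side; all others are units.\<close>

lemma padic_fact_dvd_step:
  "(fact m :: 'p::prime_card padic_int)
    dvd of_nat CARD('p) ^ (m div CARD('p)) * fact (m div CARD('p))"
proof (induction m)
  case (Suc m)
  let ?p = "of_nat CARD('p) :: 'p padic_int" and ?q = "m div CARD('p)"
  show ?case
  proof (cases "CARD('p) dvd Suc m")
    case True
    then have q: "Suc m div CARD('p) = Suc ?q"
      by (simp add: div_Suc dvd_eq_mod_eq_0)
    then have "Suc m = CARD('p) * Suc ?q"
      using True by (metis dvd_mult_div_cancel)
    then have "(of_nat (Suc m) :: 'p padic_int) = ?p * of_nat (Suc ?q)"
      by (metis of_nat_mult)
    then have "fact (Suc m) dvd (?p * of_nat (Suc ?q)) * (?p ^ ?q * fact ?q)"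
      using Suc.IH by (simp add: mult_dvd_mono del: of_nat_Suc)
    then show ?thesis
      unfolding q by (simp add: mult_ac)
  next
    case False
    then have q: "Suc m div CARD('p) = ?q"
      by (simp add: div_Suc dvd_eq_mod_eq_0)
    have "of_nat (Suc m) * fact m dvd 1 * (?p ^ ?q * fact ?q)"
      using Suc.IH padic_of_nat_unitI[OF False] by (rule mult_dvd_mono[rotated])
    then show ?thesis
      unfolding q by simp
  qed
qed simp

lemma padic_fact_dvd_power:
  assumes "5 \<le> CARD('p)"
  shows "(fact m :: 'p::prime_card padic_int) dvd of_nat CARD('p) ^ (m div 4)"
proof (induction m rule: less_induct)
  case (less m)
  let ?p = "of_nat CARD('p) :: 'p padic_int" and ?q = "m div CARD('p)"
  show ?case
  proof (cases "m = 0")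
    case False
    then have "?q < m"
      using assms by (intro div_less_dividend) auto
    have "fact m dvd ?p ^ ?q * ?p ^ (?q div 4)"
      using padic_fact_dvd_step less[OF \<open>?q < m\<close>] by (meson dvd_refl dvd_trans mult_dvd_mono)
    also have "?p ^ ?q * ?p ^ (?q div 4) dvd ?p ^ (m div 4)"
    proof -
      \<comment> \<open>Here \<open>5 \<le> p\<close> enters:
        \<open>4 * (?q + ?q div 4) \<le> 5 * ?q \<le> m\<close>, so the exponents gathered in the
        recursion stay within \<open>m div 4\<close>.\<close>
      have "5 * ?q \<le> CARD('p) * ?q"
        using assms by (intro mult_right_mono) auto
      also have "\<dots> \<le> m"
        by simp
      finally have "?q + ?q div 4 \<le> m div 4"
        by linarith
      then show ?thesis
        by (metis le_imp_power_dvd power_add)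
    qed
    finally show ?thesis .
  qed simp
qed

section \<open>Integrality of p-adic binomial coefficients\<close>

lemma prod_of_nat_diff_eq_binomial:
  "(\<Prod>i=0..<m. of_nat r - of_nat i :: 'a::{comm_ring_1,ring_char_0}) = fact m * of_nat (r choose m)"
proof (induction m)
  case (Suc m)
  have *: "(of_nat r - of_nat m) * of_nat (r choose m) = (of_nat (Suc m) * of_nat (r choose Suc m) :: 'a)"
  proof (cases "m \<le> r")
    case True
    have "(r - m) * (r choose m) = Suc m * (r choose Suc m)"
      by (simp only: binomial_absorb_comp binomial_absorption)
    then have "(of_nat (r - m) * of_nat (r choose m) :: 'a) = of_nat (Suc m) * of_nat (r choose Suc m)"
      by (metis of_nat_mult)
    then show ?thesis
      using True by (simp only: of_nat_diff)
  qed (simp add: binomial_eq_0)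
  have "(\<Prod>i=0..<Suc m. of_nat r - of_nat i :: 'a) = fact m * ((of_nat r - of_nat m) * of_nat (r choose m))"
    using Suc.IH by (simp add: mult_ac)
  then show ?case
    unfolding * by (simp add: mult_ac)
qed simp

lemma dvd_prod_diff:
  fixes f g :: "'i \<Rightarrow> 'a::comm_ring_1"
  assumes "\<And>i. i \<in> I \<Longrightarrow> D dvd f i - g i"
  shows "D dvd prod f I - prod g I"
  using assms
proof (induction I rule: infinite_finite_induct)
  case (insert i I)
  have "D dvd (f i - g i) * prod f I + g i * (prod f I - prod g I)"
    using insert by (intro dvd_add dvd_mult dvd_mult2) auto
  then show ?case
    using insert.hyps by (simp add: algebra_simps)
qed simp_all

text \<open>Density of the naturals: modulo a power of \<open>p\<close> divisible by
  \<open>m!\<close>, \<open>t\<close> may be replaced by a natural number \<open>r\<close>, where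
  the product is \<open>m!\<close> times an ordinary binomial coefficient.\<close>

lemma padic_fact_dvd_prod:
  "fact m dvd (\<Prod>i=0..<m. t - of_nat i :: 'p::prime_card padic_int)"
proof -
  have "(fact m :: 'p padic_int) \<noteq> 0"
    by (rule fact_nonzero)
  then obtain k where k: "(fact m :: 'p padic_int) dvd of_nat CARD('p) ^ k"
    by (rule padic_dvd_p_power)
  define r where "r = nat (padic_residue t k)"
  have r: "of_int (padic_residue t k) = (of_nat r :: 'p padic_int)"
    using padic_residue_bounds[of t k] by (simp add: r_def)
  have "of_nat CARD('p) ^ k dvd t - of_nat r"
    using padic_dvd_diff_residue[of k t] by (simp only: r)
  then have "of_nat CARD('p) ^ k dvd (\<Prod>i=0..<m. t - of_nat i) - (\<Prod>i=0..<m. of_nat r - of_nat i)"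
    by (intro dvd_prod_diff) simp
  then have "fact m dvd ((\<Prod>i=0..<m. t - of_nat i) - (\<Prod>i=0..<m. of_nat r - of_nat i))
      + (\<Prod>i=0..<m. of_nat r - of_nat i)"
    by (intro dvd_add) (use k dvd_trans in blast, simp add: prod_of_nat_diff_eq_binomial)
  then show ?thesis
    by simp
qed

text \<open>Division in \<open>padic_binomial\<close> yields 0 when no quotient exists; integrality
  rules that default out.\<close>

lemma fact_mult_padic_binomial:
  "fact m * padic_binomial t m = (\<Prod>i=0..<m. t - of_nat i :: 'p::prime_card padic_int)"
proof -
  obtain z where "(\<Prod>i=0..<m. t - of_nat i) = fact m * z"
    using padic_fact_dvd_prod[of m t] by (elim dvdE)
  then show ?thesis
    by (simp add: padic_binomial_def)
qed

lemma padic_binomial_of_nat: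
  "padic_binomial (of_nat r) m = (of_nat (r choose m) :: 'p::prime_card padic_int)"
proof -
  have "fact m * padic_binomial (of_nat r) m = (fact m * of_nat (r choose m) :: 'p padic_int)"
    by (simp only: fact_mult_padic_binomial prod_of_nat_diff_eq_binomial)
  then show ?thesis
    by simp
qed

text \<open>The falling factorial as a polynomial; its coefficients, signed Stirling numbers of the
  first kind, govern the passage to powers of \<open>t\<close>.\<close>

definition falling_poly :: "nat \<Rightarrow> 'a::comm_ring_1 poly" where
  "falling_poly m = (\<Prod>i=0..<m. [:- of_nat i, 1:])"

lemma poly_falling_poly: "poly (falling_poly m) t = (\<Prod>i=0..<m. t - of_nat i)"
  by (simp add: falling_poly_def poly_prod)

lemma degree_falling_poly_le: "degree (falling_poly m :: 'a::idom poly) \<le> m"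
proof -
  have "degree (falling_poly m :: 'a poly) \<le> (\<Sum>i=0..<m. degree [:- of_nat i, 1 :: 'a:])"
    unfolding falling_poly_def by (intro degree_prod_sum_le[THEN order_trans]) auto
  then show ?thesis
    by simp
qed

lemma poly_eq_sum_lessThan:
  assumes "degree f < N"
  shows "poly f (t :: 'a::comm_ring_1) = (\<Sum>n<N. coeff f n * t ^ n)"
  unfolding poly_altdef using assms
  by (intro sum.mono_neutral_left) (auto simp: coeff_eq_0)

lemma sum_coeff_falling_poly:
  fixes e :: "nat \<Rightarrow> 'a::idom"
  assumes "M \<le> N"
  shows "(\<Sum>n<N. (\<Sum>m<M. coeff (falling_poly m) n * e m) * t ^ n)
    = (\<Sum>m<M. poly (falling_poly m) t * e m)"
proof -
  have "(\<Sum>n<N. (\<Sum>m<M. coeff (falling_poly m) n * e m) * t ^ n)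
      = (\<Sum>m<M. \<Sum>n<N. coeff (falling_poly m) n * e m * t ^ n)"
    by (simp add: sum_distrib_right sum.swap[of _ "{..<N}"])
  also have "\<dots> = (\<Sum>m<M. poly (falling_poly m) t * e m)"
  proof (intro sum.cong refl)
    fix m assume "m \<in> {..<M}"
    then have "degree (falling_poly m :: 'a poly) < N"
      using assms degree_falling_poly_le[of m, where 'a = 'a] by simp
    then show "(\<Sum>n<N. coeff (falling_poly m) n * e m * t ^ n) = poly (falling_poly m) t * e m"
      by (simp add: poly_eq_sum_lessThan sum_distrib_left mult_ac)
  qed
  finally show ?thesis .
qed

text \<open>In the application \<open>e m\<close> is \<open>p ^ m / m!\<close> times a trace, with c
  subtracted at m = 0. The coefficient of \<open>t ^ n\<close> is the sum over m of
  \<open>coeff (falling_poly m) n * e m\<close>. Since one truncation point serves all n and all t,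
  only finite double sums are ever interchanged.\<close>

lemma falling_series_power_series:
  fixes e :: "nat \<Rightarrow> 'p::prime_card padic_int" and G :: "'p padic_int \<Rightarrow> 'p padic_int"
  assumes e: "\<And>m. of_nat CARD('p) ^ (m - m div 4) dvd e m"
    and G: "\<And>t. padic_sums CARD('p) (\<lambda>m. poly (falling_poly m) t * e m) (G t)"
  obtains f where "f \<in> restricted_series" "represents_function f G"
    "\<And>n. of_nat CARD('p) ^ 2 dvd fps_nth f n - (if n = 0 then e 0 else if n = 1 then e 1 else 0)"
proof -
  let ?p = "of_nat CARD('p) :: 'p padic_int"
  let ?c = "\<lambda>n m. coeff (falling_poly m) n * e m"
  \<comment> \<open>The exponent \<open>m - m div 4\<close> is at least 3m/4, so
    \<open>m \<ge> 2 * k\<close> is ample.\<close>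
  have null: "?p ^ k dvd e m" if "2 * k \<le> m" for k m
    using e[of m] that by (elim dvd_trans[rotated]) (intro le_imp_power_dvd, linarith)
  have "\<exists>s. padic_sums CARD('p) (?c n) s" for n
  proof (rule padic_null_series_sums)
    show "\<exists>N. \<forall>m\<ge>N. ?p ^ k dvd ?c n m" for k
      using null by (meson dvd_mult)
  qed blast
  then obtain S where S: "\<And>n. padic_sums CARD('p) (?c n) (S n)"
    by metis
  have tail: "?p ^ k dvd (\<Sum>m<M. ?c n m) - S n" if "2 * k \<le> M" for k M n
    using that by (intro padic_sums_tail[OF S] dvd_mult null) simp
  have G_tail: "?p ^ k dvd (\<Sum>m<M. poly (falling_poly m) t * e m) - G t" if "2 * k \<le> M" for k M t
    using that by (intro padic_sums_tail[OF G] dvd_mult null) simp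
  show thesis
  proof (rule that[of "Abs_fps S"])
    have "?p ^ k dvd S n" if "2 * k \<le> n" for k n
    proof -
      \<comment> \<open>For \<open>n \<ge> 2 * k\<close> every polynomial kept in the truncation has
        degree below n, so \<open>S n\<close> consists of its small tail alone.\<close>
      have "coeff (falling_poly m :: 'p padic_int poly) n = 0" if "m < 2 * k" for m
        using that \<open>2 * k \<le> n\<close> by (intro coeff_eq_0 le_less_trans[OF degree_falling_poly_le]) simp
      then have "(\<Sum>m<2 * k. ?c n m) = 0"
        by (intro sum.neutral) simp
      then show ?thesis
        using tail[of k "2 * k" n] by simp
    qed
    then show "Abs_fps S \<in> restricted_series"
      by (auto simp: restricted_series_def)
    show "represents_function (Abs_fps S) G"
      unfolding represents_function_def padic_sums_def fps_nth_Abs_fps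
    proof (intro allI exI impI)
      fix t :: "'p padic_int" and k N :: nat
      assume N: "2 * k \<le> N"
      have "?p ^ k dvd (\<Sum>n<N. ((\<Sum>m<2 * k. ?c n m) - S n) * t ^ n)"
        by (intro dvd_sum dvd_mult2 tail) simp
      then have "?p ^ k dvd (\<Sum>m<2 * k. poly (falling_poly m) t * e m) - (\<Sum>n<N. S n * t ^ n)"
        using N by (simp add: left_diff_distrib sum_subtractf sum_coeff_falling_poly)
      then have "?p ^ k dvd ((\<Sum>m<2 * k. poly (falling_poly m) t * e m) - G t)
          - ((\<Sum>m<2 * k. poly (falling_poly m) t * e m) - (\<Sum>n<N. S n * t ^ n))"
        using G_tail[of k "2 * k" t] dvd_diff by blast
      then show "?p ^ k dvd (\<Sum>n<N. S n * t ^ n) - G t"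
        by simp
    qed
    \<comment> \<open>From m = 2 on, \<open>m - m div 4 \<ge> 2\<close>; modulo \<open>p ^ 2\<close>
      only the falling factorials 1 and t survive.\<close>
    have "?p ^ 2 dvd e m" if "2 \<le> m" for m
      using e[of m] that by (elim dvd_trans[rotated]) (intro le_imp_power_dvd, linarith)
    then have "?p ^ 2 dvd (\<Sum>m<2. ?c n m) - S n" for n
      by (intro padic_sums_tail[OF S] dvd_mult)
    moreover have "(\<Sum>m<2. ?c n m) = (if n = 0 then e 0 else if n = 1 then e 1 else 0)" for n
      by (simp add: numeral_2_eq_2 falling_poly_def coeff_pCons split: nat.split)
    ultimately have "?p ^ 2 dvd - ((if n = 0 then e 0 else if n = 1 then e 1 else 0) - S n)" for n
      by (simp only: dvd_minus_iff)
    then show "?p ^ 2 dvd fps_nth (Abs_fps S) n - (if n = 0 then e 0 else if n = 1 then e 1 else 0)" for n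
      by (simp only: minus_diff_eq fps_nth_Abs_fps)
  qed
qed

text \<open>Each \<open>t ^ n - s ^ n\<close> contains the factor \<open>t - s\<close>, so a
  congruence modulo \<open>D\<close> of the coefficients becomes one modulo
  \<open>D * (t - s)\<close> of the values.\<close>

lemma power_series_difference:
  fixes f :: "'p::prime_card padic_int fps"
  assumes F: "represents_function f F"
    and f1: "D dvd fps_nth f 1 - \<delta>" and f2: "\<And>n. 2 \<le> n \<Longrightarrow> D dvd fps_nth f n"
    and D: "D \<noteq> 0"
  shows "D * (t - s) dvd F t - F s - \<delta> * (t - s)"
proof (cases "t = s")
  case False
  let ?p = "of_nat CARD('p) :: 'p padic_int"
  have "D * (t - s) \<noteq> 0"
    using False D by simp
  \<comment> \<open>This k makes the truncation errors multiples of \<open>D * (t - s)\<close>; the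
    choice requires \<open>t \<noteq> s\<close>, hence the case split.\<close>
  then obtain k where k: "D * (t - s) dvd ?p ^ k"
    by (rule padic_dvd_p_power)
  let ?S = "\<lambda>u N. \<Sum>n<N. fps_nth f n * u ^ n"
  have "\<exists>N. \<forall>n\<ge>N. ?p ^ k dvd ?S u n - F u" for u
    using F unfolding represents_function_def padic_sums_def by blast
  then obtain N where N: "\<And>u n. n \<ge> N u \<Longrightarrow> ?p ^ k dvd ?S u n - F u"
    by metis
  \<comment> \<open>The summand 2 guarantees that the linear term lies in the truncated
    range.\<close>
  define M where "M = N t + N s + 2"
  have "?p ^ k dvd (?S t M - F t) - (?S s M - F s)"
    by (intro dvd_diff N) (auto simp: M_def)
  then have 1: "D * (t - s) dvd (?S t M - F t) - (?S s M - F s)"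
    using k dvd_trans by blast
  have "D * (t - s) dvd fps_nth f n * (t ^ n - s ^ n) - (if n = 1 then \<delta> * (t - s) else 0)" for n
  proof -
    consider "n = 0" | "n = 1" | "n \<ge> 2"
      by linarith
    then show ?thesis
    proof cases
      case 2
      then show ?thesis
        using f1 by (simp add: mult_dvd_mono flip: left_diff_distrib)
    next
      case 3
      have "(t - s) dvd t ^ n - s ^ n"
        by (metis dvd_triv_left power_diff_sumr2)
      then show ?thesis
        using 3 f2 by (simp add: mult_dvd_mono)
    qed simp
  qed
  then have "D * (t - s) dvd (\<Sum>n<M. fps_nth f n * (t ^ n - s ^ n) - (if n = 1 then \<delta> * (t - s) else 0))"
    by (intro dvd_sum)
  also have "\<dots> = ?S t M - ?S s M - \<delta> * (t - s)"
    by (simp add: sum_subtractf right_diff_distrib M_def)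
  finally have "D * (t - s) dvd (?S t M - ?S s M - \<delta> * (t - s)) - ((?S t M - F t) - (?S s M - F s))"
    using 1 dvd_diff by blast
  then show ?thesis
    by (simp add: algebra_simps)
qed simp

text \<open>Evaluate at \<open>p ^ k\<close>: the lowest coefficient on which the two series differ is divisible by
  every power of \<open>p\<close>.\<close>

lemma represents_function_unique:
  fixes f g :: "'p::prime_card padic_int fps"
  assumes "represents_function f F" "represents_function g F"
  shows "f = g"
proof (rule fps_ext)
  let ?p = "of_nat CARD('p) :: 'p padic_int"
  fix n
  show "fps_nth f n = fps_nth g n"
  proof (induction n rule: less_induct)
    case (less n)
    have "?p ^ k dvd fps_nth f n - fps_nth g n" for k
    proof -
      \<comment> \<open>The precision \<open>?K\<close> is the exponent of
        \<open>?t ^ Suc n\<close>: higher terms disappear, and cancelling \<open>?t ^ n\<close> from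
        the remaining one leaves precision k.\<close>
      let ?h = "\<lambda>i. fps_nth f i - fps_nth g i" and ?t = "?p ^ k" and ?K = "k * n + k"
      have "\<exists>N. \<forall>m\<ge>N. ?p ^ ?K dvd (\<Sum>i<m. fps_nth f i * ?t ^ i) - F ?t"
        "\<exists>N. \<forall>m\<ge>N. ?p ^ ?K dvd (\<Sum>i<m. fps_nth g i * ?t ^ i) - F ?t"
        using assms unfolding represents_function_def padic_sums_def by blast+
      then obtain N N' where
          N: "\<And>m. m \<ge> N \<Longrightarrow> ?p ^ ?K dvd (\<Sum>i<m. fps_nth f i * ?t ^ i) - F ?t"
        and N': "\<And>m. m \<ge> N' \<Longrightarrow> ?p ^ ?K dvd (\<Sum>i<m. fps_nth g i * ?t ^ i) - F ?t"
        by blast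
      define M where "M = Suc n + N + N'"
      have "?p ^ ?K dvd ((\<Sum>i<M. fps_nth f i * ?t ^ i) - F ?t) - ((\<Sum>i<M. fps_nth g i * ?t ^ i) - F ?t)"
        by (intro dvd_diff N N') (auto simp: M_def)
      then have 1: "?p ^ ?K dvd (\<Sum>i<M. ?h i * ?t ^ i)"
        by (simp add: left_diff_distrib sum_subtractf)
      have "?p ^ ?K dvd ?h i * ?t ^ i" if "i \<ge> Suc n" for i
      proof -
        have "k * Suc n \<le> k * i"
          using that by (rule mult_le_mono2)
        then show ?thesis
          by (intro dvd_mult) (simp add: le_imp_power_dvd add.commute flip: power_mult)
      qed
      then have 2: "?p ^ ?K dvd (\<Sum>i<M. ?h i * ?t ^ i) - (\<Sum>i<Suc n. ?h i * ?t ^ i)"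
        by (intro dvd_partial_sum_diff) (auto simp: M_def)
      have "?p ^ ?K dvd (\<Sum>i<Suc n. ?h i * ?t ^ i)"
        using dvd_diff[OF 1 2] by simp
      also have "(\<Sum>i<Suc n. ?h i * ?t ^ i) = ?h n * ?p ^ (k * n)"
        using less by (simp flip: power_mult)
      finally show ?thesis
        using padic_p_nonzero[where 'p = 'p] by (simp add: power_add mult.commute)
    qed
    then show ?case
      using padic_eq_0I by (metis eq_iff_diff_eq_0)
  qed
qed


section \<open>Free algebras, traces and reduction modulo $p$\<close>

locale free_comm_algebra = comm_algebra scale
  for scale :: "'r::comm_ring_1 \<Rightarrow> 'a::{comm_ring,comm_monoid_mult} \<Rightarrow> 'a" +
  fixes B :: "'a set"
  assumes basis: "is_module_basis scale B"
begin

lemma finite_basis: "finite B"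
  and independent_basis: "independent B"
  and in_span_basis: "v \<in> span B"
  using basis by (auto simp: is_module_basis_def)

abbreviation coord :: "'a \<Rightarrow> 'a \<Rightarrow> 'r" where
  "coord \<equiv> representation B"

lemma sum_coord: "(\<Sum>b\<in>B. scale (coord v b) b) = v"
  by (intro sum_representation_eq finite_basis independent_basis in_span_basis) auto

lemmas coord_add = representation_add[OF independent_basis in_span_basis in_span_basis]
  and coord_diff = representation_diff[OF independent_basis in_span_basis in_span_basis]
  and coord_scale = representation_scale[OF independent_basis in_span_basis]
  and coord_sum = representation_sum[OF independent_basis in_span_basis]
  and coord_basis = representation_basis[OF independent_basis]

lemma coord_linear_combination:
  assumes "b \<in> B"
  shows "coord (\<Sum>b\<in>B. scale (u b) b) b = u b"
  using assms finite_basis by (simp add: coord_sum coord_scale coord_basis if_distrib cong: if_cong)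

lemma eq_if_coord_eq:
  assumes "\<And>b. b \<in> B \<Longrightarrow> coord v b = coord w b"
  shows "v = w"
proof -
  have "(\<Sum>b\<in>B. scale (coord v b) b) = (\<Sum>b\<in>B. scale (coord w b) b)"
    using assms by (intro sum.cong) auto
  then show ?thesis
    by (simp add: sum_coord)
qed

lemma scale_mult_right: "scale r (x * y) = x * scale r y"
  using scale_mult_left[of r y x] by (simp add: mult.commute)

text \<open>The matrices of multiplication by \<open>x\<close> in the two bases are conjugate.\<close>

lemma trace_basis_independent:
  assumes C: "is_module_basis scale C"
  shows "(\<Sum>b\<in>B. coord (x * b) b) = (\<Sum>c\<in>C. representation C (x * c) c)"
proof -
  interpret C: free_comm_algebra scale C
    by unfold_locales (rule C)
  have "(\<Sum>b\<in>B. coord (x * b) b) = (\<Sum>b\<in>B. \<Sum>c\<in>C. C.coord b c * coord (x * c) b)"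
  proof (intro sum.cong refl)
    fix b assume "b \<in> B"
    have "x * b = (\<Sum>c\<in>C. scale (C.coord b c) (x * c))"
      by (subst C.sum_coord[of b, symmetric]) (simp add: sum_distrib_left scale_mult_right)
    then show "coord (x * b) b = (\<Sum>c\<in>C. C.coord b c * coord (x * c) b)"
      by (simp add: coord_sum coord_scale)
  qed
  also have "\<dots> = (\<Sum>c\<in>C. \<Sum>b\<in>B. coord (x * c) b * C.coord b c)"
    by (subst sum.swap) (simp add: mult.commute)
  also have "\<dots> = (\<Sum>c\<in>C. C.coord (x * c) c)"
  proof (intro sum.cong refl)
    fix c assume "c \<in> C"
    have "C.coord (x * c) c = C.coord (\<Sum>b\<in>B. scale (coord (x * c) b) b) c"
      by (simp only: sum_coord)
    then show "(\<Sum>b\<in>B. coord (x * c) b * C.coord b c) = C.coord (x * c) c"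
      by (simp add: C.coord_sum C.coord_scale)
  qed
  finally show ?thesis .
qed

text \<open>The basis chosen by \<open>SOME\<close> is opaque; basis independence allows computing
  in \<open>B\<close>.\<close>

lemma algebra_trace_eq: "algebra_trace scale x = (\<Sum>b\<in>B. coord (x * b) b)"
proof -
  have "is_module_basis scale (SOME C. is_module_basis scale C)"
    using basis by (rule someI)
  then show ?thesis
    unfolding algebra_trace_def Let_def using trace_basis_independent by metis
qed

lemma algebra_trace_add:
  "algebra_trace scale (x + y) = algebra_trace scale x + algebra_trace scale y"
  by (simp add: algebra_trace_eq distrib_right coord_add sum.distrib)

lemma algebra_trace_diff:
  "algebra_trace scale (x - y) = algebra_trace scale x - algebra_trace scale y"
  by (simp add: algebra_trace_eq left_diff_distrib coord_diff sum_subtractf)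

lemma algebra_trace_scale: "algebra_trace scale (scale r x) = r * algebra_trace scale x"
  by (simp add: algebra_trace_eq coord_scale sum_distrib_left flip: scale_mult_left)

lemma algebra_trace_zero: "algebra_trace scale 0 = 0"
  using algebra_trace_diff[of 0 0] by simp

lemma algebra_trace_sum:
  "algebra_trace scale (\<Sum>i\<in>I. f i) = (\<Sum>i\<in>I. algebra_trace scale (f i))"
  by (induction I rule: infinite_finite_induct) (simp_all add: algebra_trace_add algebra_trace_zero)

end

section \<open>Convergence in a free algebra over the p-adic integers\<close>

locale free_padic_algebra = free_comm_algebra scale B
  for scale :: "'p::prime_card padic_int \<Rightarrow> 'a::comm_ring_1 \<Rightarrow> 'a" and B
begin

lemma scale_of_nat: "scale (of_nat n) y = of_nat n * y"
  by (induction n) (simp_all add: scale_left_distrib distrib_right)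

lemma scale_p_power_mult: "scale (of_nat n ^ k * r) y = of_nat n ^ k * scale r y"
  using scale_of_nat[of "n ^ k" "scale r y"] by simp

lemma p_power_mult_eq_scale: "of_nat n ^ k * y = scale (of_nat n ^ k) y"
  using scale_of_nat[of "n ^ k" y] by simp

lemma p_power_dvd_scale: "of_nat n ^ k dvd r \<Longrightarrow> of_nat n ^ k dvd scale r y"
  by (auto simp: dvd_def scale_p_power_mult)

lemma p_power_dvd_coord: "of_nat n ^ k dvd y \<Longrightarrow> of_nat n ^ k dvd coord y b"
  by (auto simp: dvd_def p_power_mult_eq_scale coord_scale)

lemma p_power_dvd_trace:
  "of_nat n ^ k dvd y \<Longrightarrow> of_nat n ^ k dvd algebra_trace scale y"
  by (auto simp: dvd_def p_power_mult_eq_scale algebra_trace_scale)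

text \<open>Separatedness is inherited coordinatewise from the p-adic integers; it makes sums of
  series unique.\<close>

lemma eq_if_p_powers_dvd:
  fixes y z :: 'a
  assumes "\<And>k. of_nat CARD('p) ^ k dvd y - z"
  shows "y = z"
proof (rule eq_if_coord_eq)
  fix b
  have "of_nat CARD('p) ^ k dvd coord y b - coord z b" for k
    using p_power_dvd_coord[OF assms[of k], of b] by (simp add: coord_diff)
  then show "coord y b = coord z b"
    using padic_eq_0I by (metis eq_iff_diff_eq_0)
qed

lemma padic_sums_unique:
  assumes "padic_sums CARD('p) f (s :: 'a)" "padic_sums CARD('p) f s'"
  shows "s = s'"
proof (rule eq_if_p_powers_dvd)
  fix k
  obtain N N' where
      N: "\<And>n. n \<ge> N \<Longrightarrow> of_nat CARD('p) ^ k dvd (\<Sum>m<n. f m) - s"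
    and N': "\<And>n. n \<ge> N' \<Longrightarrow> of_nat CARD('p) ^ k dvd (\<Sum>m<n. f m) - s'"
    using assms unfolding padic_sums_def by meson
  have "of_nat CARD('p) ^ k dvd ((\<Sum>m<max N N'. f m) - s') - ((\<Sum>m<max N N'. f m) - s)"
    by (intro dvd_diff N N') auto
  then show "of_nat CARD('p) ^ k dvd s - s'"
    by simp
qed

text \<open>Completeness is also coordinatewise: all coordinates are at least as divisible as the
  terms, so one threshold serves the whole basis.\<close>

lemma null_series_sums:
  fixes f :: "nat \<Rightarrow> 'a"
  assumes "\<And>k. \<exists>N. \<forall>n\<ge>N. of_nat CARD('p) ^ k dvd f n"
  obtains s where "padic_sums CARD('p) f s"
proof -
  have "\<exists>S. padic_sums CARD('p) (\<lambda>n. coord (f n) b) S" for b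
  proof (rule padic_null_series_sums)
    show "\<exists>N. \<forall>n\<ge>N. of_nat CARD('p) ^ k dvd coord (f n) b" for k
      using assms p_power_dvd_coord by meson
  qed blast
  then obtain S where S: "\<And>b. padic_sums CARD('p) (\<lambda>n. coord (f n) b) (S b)"
    by metis
  have "padic_sums CARD('p) f (\<Sum>b\<in>B. scale (S b) b)"
    unfolding padic_sums_def
  proof
    fix k
    obtain N where N: "\<And>n. n \<ge> N \<Longrightarrow> of_nat CARD('p) ^ k dvd f n"
      using assms by meson
    have "of_nat CARD('p) ^ k dvd (\<Sum>m<n. f m) - (\<Sum>b\<in>B. scale (S b) b)" if "n \<ge> N" for n
    proof -
      have "of_nat CARD('p) ^ k dvd (\<Sum>m<n. coord (f m) b) - S b" for b
        using that by (intro padic_sums_tail[OF S] p_power_dvd_coord N) simp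
      then have "of_nat CARD('p) ^ k dvd (\<Sum>b\<in>B. scale ((\<Sum>m<n. coord (f m) b) - S b) b)"
        by (intro dvd_sum p_power_dvd_scale)
      moreover have "(\<Sum>m<n. f m) = (\<Sum>b\<in>B. scale (\<Sum>m<n. coord (f m) b) b)"
        using sum_coord[of "\<Sum>m<n. f m"] by (simp add: coord_sum)
      ultimately show ?thesis
        by (simp add: scale_left_diff_distrib sum_subtractf)
    qed
    then show "\<exists>N. \<forall>n\<ge>N. of_nat CARD('p) ^ k dvd (\<Sum>m<n. f m) - (\<Sum>b\<in>B. scale (S b) b)"
      by blast
  qed
  then show thesis
    by (rule that)
qed

lemma padic_sums_trace:
  assumes "padic_sums CARD('p) f s"
  shows "padic_sums CARD('p) (\<lambda>m. algebra_trace scale (y * f m)) (algebra_trace scale (y * s))"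
  unfolding padic_sums_def
proof
  fix k
  obtain N where N: "\<And>n. n \<ge> N \<Longrightarrow> of_nat CARD('p) ^ k dvd (\<Sum>m<n. f m) - s"
    using assms unfolding padic_sums_def by meson
  have "of_nat CARD('p) ^ k dvd (\<Sum>m<n. algebra_trace scale (y * f m)) - algebra_trace scale (y * s)"
    if "n \<ge> N" for n
  proof -
    have "of_nat CARD('p) ^ k dvd algebra_trace scale (y * ((\<Sum>m<n. f m) - s))"
      by (intro p_power_dvd_trace dvd_mult N that)
    then show ?thesis
      by (simp add: right_diff_distrib sum_distrib_left algebra_trace_diff algebra_trace_sum)
  qed
  then show "\<exists>N. \<forall>n\<ge>N. of_nat CARD('p) ^ k dvd
      (\<Sum>m<n. algebra_trace scale (y * f m)) - algebra_trace scale (y * s)"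
    by blast
qed

text \<open>Because \<open>u - 1\<close> is divisible by \<open>p\<close>, the m-th term is
  divisible by \<open>p ^ m\<close>. Existence and uniqueness of the sum justify the
  \<open>THE\<close> in \<open>binomial_power\<close>.\<close>

lemma padic_sums_binomial_power:
  assumes u: "u = 1 + of_nat CARD('p) * v"
  shows "padic_sums CARD('p) (\<lambda>m. scale (padic_binomial t m) ((u - 1) ^ m))
    (binomial_power scale u t)"
proof -
  let ?f = "\<lambda>m. scale (padic_binomial t m) ((u - 1) ^ m)"
  have "of_nat CARD('p) ^ k dvd ?f m" if "k \<le> m" for k m
  proof -
    have "?f m = of_nat CARD('p) ^ m * scale (padic_binomial t m) (v ^ m)"
      by (simp add: u power_mult_distrib scale_mult_right)
    then show ?thesis
      using that by (simp add: le_imp_power_dvd)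
  qed
  then obtain s where s: "padic_sums CARD('p) ?f s"
    using null_series_sums[of ?f] by meson
  then have "\<exists>!s. padic_sums CARD('p) ?f s"
    using padic_sums_unique by blast
  then show ?thesis
    unfolding binomial_power_def by (rule theI')
qed

text \<open>At a natural exponent the series stops and is the binomial theorem; this ties the
  interpolating function to the actual trace sequence.\<close>

lemma binomial_power_of_nat:
  assumes u: "u = 1 + of_nat CARD('p) * v"
  shows "binomial_power scale u (of_nat r) = u ^ r"
proof (rule padic_sums_unique)
  show "padic_sums CARD('p) (\<lambda>m. scale (padic_binomial (of_nat r) m) ((u - 1) ^ m))
      (binomial_power scale u (of_nat r))"
    by (rule padic_sums_binomial_power) (rule u)
  have "(\<Sum>m<n. scale (padic_binomial (of_nat r) m) ((u - 1) ^ m)) = u ^ r" if "n \<ge> Suc r" for n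
  proof -
    have "u ^ r = (\<Sum>m\<le>r. of_nat (r choose m) * (u - 1) ^ m)"
      using binomial_ring[of "u - 1" 1 r] by simp
    also have "\<dots> = (\<Sum>m<n. of_nat (r choose m) * (u - 1) ^ m)"
      using that by (intro sum.mono_neutral_left) (auto simp: not_le binomial_eq_0)
    finally show ?thesis
      by (simp add: padic_binomial_of_nat scale_of_nat)
  qed
  then show "padic_sums CARD('p) (\<lambda>m. scale (padic_binomial (of_nat r) m) ((u - 1) ^ m)) (u ^ r)"
    unfolding padic_sums_def by (metis diff_self dvd_0_right)
qed

end

section \<open>Reduction of the algebra modulo p\<close>

lemma to_mod_p_eq_iff:
  "(to_mod_p x :: ('a::comm_ring_1, 'p::prime_card) mod_p) = to_mod_p y
    \<longleftrightarrow> of_nat CARD('p) dvd x - y"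
  by (rule mod_p.abs_eq_iff)

lemma to_mod_p_mult:
  "to_mod_p (x * y) = (to_mod_p x * to_mod_p y :: ('a::comm_ring_1, 'p::prime_card) mod_p)"
  by (simp add: times_mod_p.abs_eq)

lemma to_mod_p_power:
  "to_mod_p (x ^ n) = (to_mod_p x ^ n :: ('a::comm_ring_1, 'p::prime_card) mod_p)"
  by (induction n) (simp_all add: to_mod_p_mult one_mod_p_def)

lemma to_mod_p_add:
  "to_mod_p (x + y) = (to_mod_p x + to_mod_p y :: ('a::comm_ring_1, 'p::prime_card) mod_p)"
  by (simp add: plus_mod_p.abs_eq)

lemma to_mod_p_sum:
  "to_mod_p (\<Sum>i\<in>I. f i) = (\<Sum>i\<in>I. to_mod_p (f i) :: ('a::comm_ring_1, 'p::prime_card) mod_p)"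
  by (induction I rule: infinite_finite_induct) (simp_all add: to_mod_p_add zero_mod_p_def)

lemma to_mod_p_surj: "\<exists>x. y = (to_mod_p x :: ('a::comm_ring_1, 'p::prime_card) mod_p)"
  by (metis Quotient_mod_p Quotient_abs_rep)

lemma of_int_cong_mod_p:
  assumes "a mod int CARD('p) = b mod int CARD('p)"
  shows "(to_mod_p (of_int a * x) :: ('a::comm_ring_1, 'p::prime_card) mod_p) = to_mod_p (of_int b * x)"
proof -
  obtain k where "a - b = int CARD('p) * k"
    using assms by (metis dvdE mod_eq_dvd_iff)
  then have "(of_int a - of_int b :: 'a) = of_nat CARD('p) * of_int k"
    by (metis of_int_diff of_int_mult of_int_of_nat_eq)
  then have "of_int a * x - of_int b * x = of_nat CARD('p) * (of_int k * x)"
    by (simp add: mult.assoc flip: left_diff_distrib)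
  then show ?thesis
    unfolding to_mod_p_eq_iff by (rule dvdI)
qed

text \<open>Frees the scalar action from canonical representatives, reducing the algebra laws to
  integer arithmetic.\<close>

lemma Fp_scale_of_int:
  "Fp_scale (of_int_mod_ring k) (to_mod_p x)
    = (to_mod_p (of_int k * x) :: ('a::comm_ring_1, 'p::prime_card) mod_p)"
proof -
  have "to_int_mod_ring (of_int_mod_ring k :: 'p mod_ring) mod int CARD('p) = k mod int CARD('p)"
    by transfer simp
  then show ?thesis
    unfolding Fp_scale.abs_eq by (rule of_int_cong_mod_p)
qed

interpretation Fp: comm_algebra "Fp_scale :: 'p::prime_card mod_ring \<Rightarrow> ('a::comm_ring_1, 'p) mod_p \<Rightarrow> _"
proof
  fix r s :: "'p mod_ring" and x y :: "('a, 'p) mod_p"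
  obtain k l where kl: "r = of_int_mod_ring k" "s = of_int_mod_ring l"
    by (metis of_int_mod_ring_to_int_mod_ring)
  obtain u v where uv: "x = to_mod_p u" "y = to_mod_p v"
    using to_mod_p_surj by metis
  have add: "r + s = of_int_mod_ring (k + l)" and mult: "r * s = of_int_mod_ring (k * l)"
    unfolding kl by
    (transfer, simp add: mod_simps)+
  show "Fp_scale r (x + y) = Fp_scale r x + Fp_scale r y"
    unfolding kl uv plus_mod_p.abs_eq Fp_scale_of_int by (simp add: distrib_left)
  show "Fp_scale (r + s) x = Fp_scale r x + Fp_scale s x"
    unfolding add unfolding kl uv Fp_scale_of_int plus_mod_p.abs_eq by (simp add: distrib_right)
  show "Fp_scale r (Fp_scale s x) = Fp_scale (r * s) x"
    unfolding mult unfolding kl uv Fp_scale_of_int by (simp add: mult.assoc)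
  have one: "(1 :: 'p mod_ring) = of_int_mod_ring 1"
    by transfer simp
  show "Fp_scale 1 x = x"
    unfolding one uv Fp_scale_of_int by simp
  show "Fp_scale r (x * y) = Fp_scale r x * y"
    unfolding kl uv times_mod_p.abs_eq Fp_scale_of_int by (simp add: mult.assoc)
qed

context free_padic_algebra
begin

abbreviation red :: "'a \<Rightarrow> ('a, 'p) mod_p" where
  "red \<equiv> to_mod_p"

lemma scale_of_int: "scale (of_int k) y = of_int k * y"
  by (cases k) (simp_all add: scale_of_nat scale_minus_left del: of_nat_Suc)

lemma red_scale: "red (scale r y) = Fp_scale (padic_to_Fp r) (red y)"
proof -
  have "of_nat CARD('p) ^ 1 dvd scale (r - of_int (padic_residue r 1)) y"
    by (rule p_power_dvd_scale) (rule padic_dvd_diff_residue)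
  then have "red (scale r y) = red (of_int (padic_residue r 1) * y)"
    by (simp add: to_mod_p_eq_iff scale_left_diff_distrib scale_of_int)
  then show ?thesis
    by (simp add: padic_to_Fp_def Fp_scale_of_int)
qed

lemma inj_on_red_basis: "inj_on red B"
proof (rule inj_onI, rule ccontr)
  fix b b' assume B: "b \<in> B" "b' \<in> B" and "red b = red b'" "b \<noteq> b'"
  then have "of_nat CARD('p) ^ 1 dvd coord (b - b') b"
    by (intro p_power_dvd_coord) (simp add: to_mod_p_eq_iff)
  then show False
    using B \<open>b \<noteq> b'\<close> padic_not_p_dvd_1[where 'p = 'p] by (simp add: coord_diff coord_basis)
qed

lemma red_eq_sum: "red y = (\<Sum>b\<in>B. Fp_scale (padic_to_Fp (coord y b)) (red b))"
  by (subst sum_coord[of y, symmetric]) (simp only: to_mod_p_sum red_scale)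

lemma padic_to_Fp_surj: "\<exists>x :: 'p padic_int. padic_to_Fp x = r"
proof -
  have "padic_to_Fp (of_int (to_int_mod_ring r) :: 'p padic_int) = r"
    by (simp add: padic_to_Fp_def padic_residue_of_int of_int_mod_ring_mod_card)
  then show ?thesis ..
qed

lemma is_module_basis_red: "is_module_basis Fp_scale (red ` B)"
  unfolding is_module_basis_def
proof (intro conjI)
  show "finite (red ` B)"
    using finite_basis by simp
  show "Fp.independent (red ` B)"
  proof
    assume "Fp.dependent (red ` B)"
    then obtain f x where 0: "(\<Sum>x\<in>red ` B. Fp_scale (f x) x) = 0" and "x \<in> red ` B" "f x \<noteq> 0"
      using Fp.dependent_finite[of "red ` B"] finite_basis by auto
    then obtain b where b: "b \<in> B" "x = red b"
      by blast
    \<comment> \<open>A set-theoretic section of the residue map lifts the relation to the algebra;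
      its coordinates there must all be divisible by \<open>p\<close>.\<close>
    obtain g where g: "\<And>r. padic_to_Fp (g r :: 'p padic_int) = r"
      using padic_to_Fp_surj by metis
    have "(\<Sum>b\<in>B. Fp_scale (f (red b)) (red b)) = 0"
      using 0 by (simp add: sum.reindex[OF inj_on_red_basis])
    then have "red (\<Sum>b\<in>B. scale (g (f (red b))) b) = red 0"
      by (simp add: to_mod_p_sum red_scale g zero_mod_p_def)
    then have "of_nat CARD('p) ^ 1 dvd (\<Sum>b\<in>B. scale (g (f (red b))) b)"
      by (simp add: to_mod_p_eq_iff)
    then have "of_nat CARD('p) ^ 1 dvd coord (\<Sum>b\<in>B. scale (g (f (red b))) b) b"
      by (rule p_power_dvd_coord)
    then have "of_nat CARD('p) dvd g (f (red b))"
      using b by (simp add: coord_linear_combination)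
    then show False
      using g b \<open>f x \<noteq> 0\<close> by (metis padic_to_Fp_eq_0_iff)
  qed
  show "Fp.span (red ` B) = UNIV"
  proof -
    have "x \<in> Fp.span (red ` B)" for x
    proof -
      obtain y where "x = red y"
        using to_mod_p_surj by blast
      then have "x = (\<Sum>b\<in>B. Fp_scale (padic_to_Fp (coord y b)) (red b))"
        using red_eq_sum by (rule trans)
      moreover have "\<dots> \<in> Fp.span (red ` B)"
        by (intro Fp.span_sum Fp.span_scale Fp.span_base imageI)
      ultimately show ?thesis
        by (rule ssubst)
    qed
    then show ?thesis
      by blast
  qed
qed

sublocale bar: free_comm_algebra "Fp_scale :: 'p mod_ring \<Rightarrow> ('a, 'p) mod_p \<Rightarrow> _" "red ` B"
  by unfold_locales (rule is_module_basis_red)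

lemma coord_red:
  assumes "b \<in> B"
  shows "bar.coord (red y) (red b) = padic_to_Fp (coord y b)"
proof -
  have "red y = (\<Sum>x\<in>red ` B. Fp_scale (padic_to_Fp (coord y (inv_into B red x))) x)"
    by (simp add: sum.reindex[OF inj_on_red_basis] inj_on_red_basis flip: red_eq_sum)
  then show ?thesis
    using assms by (simp only: bar.coord_linear_combination imageI) (simp add: inj_on_red_basis)
qed

text \<open>The matrix of multiplication by \<open>red y\<close> in the reduced basis is the
  entrywise reduction of that of \<open>y\<close>.\<close>

lemma trace_red: "algebra_trace Fp_scale (red y) = padic_to_Fp (algebra_trace scale y)"
  by (simp add: bar.algebra_trace_eq algebra_trace_eq sum.reindex[OF inj_on_red_basis]
      padic_to_Fp_sum coord_red flip: to_mod_p_mult)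

lemma finite_mod_p: "finite (UNIV :: ('a, 'p) mod_p set)"
proof -
  have "y \<in> (\<lambda>u. \<Sum>b\<in>B. Fp_scale (u b) (red b)) ` (B \<rightarrow>\<^sub>E UNIV)" for y :: "('a, 'p) mod_p"
  proof -
    obtain x where "y = red x"
      using to_mod_p_surj by blast
    then have "y = (\<Sum>b\<in>B. Fp_scale (restrict (\<lambda>b. padic_to_Fp (coord x b)) B b) (red b))"
      by (simp add: red_eq_sum[of x])
    then show ?thesis
      by (rule image_eqI[where x = "restrict (\<lambda>b. padic_to_Fp (coord x b)) B"]) simp
  qed
  then have "UNIV \<subseteq> (\<lambda>u. \<Sum>b\<in>B. Fp_scale (u b) (red b)) ` (B \<rightarrow>\<^sub>E UNIV)"
    by blast
  then show ?thesis
    by (rule finite_subset) (intro finite_imageI finite_PiE finite_basis finite)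
qed

text \<open>Excludes the default value 0 of \<open>mult_order\<close>: powers repeat in the finite
  quotient, and a unit can be cancelled.\<close>

lemma mult_order_red_pos:
  assumes "\<eta> dvd 1"
  shows "0 < mult_order (red \<eta>)"
proof -
  have "\<not> inj (\<lambda>n::nat. red \<eta> ^ n)"
    using finite_mod_p by (metis finite_imageD finite_subset infinite_UNIV_nat subset_UNIV)
  then obtain i j where ij: "i < j" "red \<eta> ^ i = red \<eta> ^ j"
    unfolding inj_def by (metis linorder_neqE_nat)
  obtain z where z: "1 = \<eta> * z"
    using assms ..
  then have z: "red \<eta> ^ i * red z ^ i = 1"
    by (metis one_mod_p_def power_one power_mult_distrib to_mod_p_mult)
  have "red \<eta> ^ (j - i) = (red \<eta> ^ i * red z ^ i) * red \<eta> ^ (j - i)"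
    unfolding z by simp
  also have "\<dots> = (red \<eta> ^ i * red \<eta> ^ (j - i)) * red z ^ i"
    by (simp only: mult_ac)
  also have "red \<eta> ^ i * red \<eta> ^ (j - i) = red \<eta> ^ i"
    unfolding power_add[symmetric] using ij by (simp only: le_add_diff_inverse less_imp_le)
  finally have "red \<eta> ^ (j - i) = 1"
    unfolding z .
  then have ex: "\<exists>n>0. red \<eta> ^ n = 1"
    using ij(1) by (metis zero_less_diff)
  then have "0 < (LEAST n. 0 < n \<and> red \<eta> ^ n = 1)"
    using LeastI_ex[of "\<lambda>n. 0 < n \<and> red \<eta> ^ n = 1"] by simp
  then show ?thesis
    using ex by (simp add: mult_order_def)
qed

end


section \<open>Zeros of functions that are affine modulo $p$\<close>

lemma enat_le_if_enat_le:
  assumes "\<And>k. enat k \<le> x \<Longrightarrow> enat k \<le> y"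
  shows "x \<le> y"
proof (cases x)
  case infinity
  then have "enat k \<le> y" for k
    by (intro assms) simp
  then have "y \<noteq> enat m" for m
    by (metis Suc_n_not_le_n enat_ord_simps(1))
  then show ?thesis
    by (cases y) auto
qed (use assms in simp)

text \<open>Isolates what the study of zeros needs from the trace function: divided differences of
  \<open>F / p\<close> are congruent to \<delta> modulo \<open>p\<close>, and its values are
  integral.\<close>

locale padic_affine_mod_p =
  fixes F :: "'p::prime_card padic_int \<Rightarrow> 'p padic_int" and \<delta> :: "'p padic_int"
  assumes expansion:
      "of_nat CARD('p) ^ 2 * (t - s) dvd F t - F s - of_nat CARD('p) * \<delta> * (t - s)"
    and p_dvd_F_0: "of_nat CARD('p) dvd F 0"
begin

abbreviation p :: "'p padic_int" where
  "p \<equiv> of_nat CARD('p)"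

lemma difference_factor:
  obtains h where "F t - F s = p * ((t - s) * (\<delta> + p * h))"
proof -
  obtain h where "F t - F s - p * \<delta> * (t - s) = p ^ 2 * (t - s) * h"
    using expansion[of t s] ..
  then have "F t - F s = p * ((t - s) * (\<delta> + p * h))"
    by (simp add: algebra_simps power2_eq_square)
  then show thesis
    by (rule that)
qed

lemma F_cong:
  assumes "p ^ k dvd t - s"
  shows "p ^ Suc k dvd F t - F s"
proof -
  obtain h where h: "F t - F s = p * ((t - s) * (\<delta> + p * h))"
    by (rule difference_factor)
  show ?thesis
    unfolding h power_Suc by (intro mult_dvd_mono dvd_refl dvd_mult2 assms)
qed

lemma p_dvd_F: "p dvd F t"
proof -
  have "p dvd F t - F 0"
    using F_cong[of 0 t 0] by simp
  then have "p dvd (F t - F 0) + F 0"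
    using p_dvd_F_0 by (rule dvd_add)
  then show ?thesis
    by simp
qed

text \<open>If \<delta> is a unit then so is \<open>\<delta> + p * h\<close>, so
  \<open>F / p\<close> preserves p-adic distances exactly.\<close>

lemma F_cong_iff:
  assumes "\<not> p dvd \<delta>"
  shows "p ^ Suc k dvd F t - F s \<longleftrightarrow> p ^ k dvd t - s"
proof
  assume *: "p ^ Suc k dvd F t - F s"
  obtain h where h: "F t - F s = p * ((t - s) * (\<delta> + p * h))"
    by (rule difference_factor)
  have "\<not> p dvd \<delta> + p * h"
    using assms by (simp add: dvd_add_left_iff)
  then have "\<delta> + p * h dvd 1"
    by (rule padic_unitI)
  then obtain w where w: "1 = (\<delta> + p * h) * w" ..
  have "p ^ k dvd (t - s) * (\<delta> + p * h)"
    using * padic_p_nonzero[where 'p = 'p] unfolding h by simp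
  then have "p ^ k dvd (t - s) * (\<delta> + p * h) * w"
    by (rule dvd_mult2)
  then show "p ^ k dvd t - s"
    by (simp add: mult.assoc flip: w)
qed (rule F_cong)

text \<open>Since \<open>F t / p mod p ^ k\<close> depends injectively on \<open>t mod p ^ k\<close>, it takes the value \<open>0\<close>.\<close>

lemma approximate_root:
  assumes "\<not> p dvd \<delta>"
  obtains t where "p ^ Suc k dvd F t"
proof -
  let ?A = "{0..<int CARD('p) ^ k}"
  have "\<forall>t. \<exists>h. F t = p * h"
    using p_dvd_F unfolding dvd_def by blast
  then obtain H where H: "\<And>t. F t = p * H t"
    by metis
  let ?f = "\<lambda>n. padic_residue (H (of_int n)) k"
  have "inj_on ?f ?A"
  proof (rule inj_onI)
    fix m n assume mn: "m \<in> ?A" "n \<in> ?A" "?f m = ?f n"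
    have "p ^ k dvd H (of_int m) - H (of_int n)"
      using mn(3) by (rule padic_residue_eq_iff[THEN iffD1])
    then have "p ^ Suc k dvd p * (H (of_int m) - H (of_int n))"
      unfolding power_Suc by (intro mult_dvd_mono dvd_refl)
    then have "p ^ Suc k dvd F (of_int m) - F (of_int n)"
      by (simp only: H right_diff_distrib)
    then have "p ^ k dvd of_int m - of_int n"
      by (simp only: F_cong_iff[OF assms])
    then have "m mod int CARD('p) ^ k = n mod int CARD('p) ^ k"
      by (simp add: padic_residue_of_int flip: padic_residue_eq_iff)
    then show "m = n"
      using mn by simp
  qed
  moreover have "?f ` ?A \<subseteq> ?A"
    using padic_residue_bounds by blast
  ultimately have "?f ` ?A = ?A"
    by (intro endo_inj_surj) auto
  moreover have "0 \<in> ?A"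
    using padic_card_gt_1[where 'p = 'p] by simp
  ultimately obtain n where "padic_residue (H (of_int n)) k = 0"
    by (metis (mono_tags, lifting) imageE)
  then have "p ^ Suc k dvd F (of_int n)"
    unfolding H power_Suc by (intro mult_dvd_mono dvd_refl) (simp only: padic_power_dvd_iff)
  then show thesis
    by (rule that)
qed

text \<open>The approximate roots are chosen independently, but the isometry property forces
  consecutive ones to agree modulo \<open>p ^ k\<close>; hence they converge, and \<open>F\<close>
  vanishes at the limit.\<close>

lemma root:
  assumes "\<not> p dvd \<delta>"
  obtains \<tau> where "F \<tau> = 0"
proof -
  have "\<exists>t. p ^ Suc k dvd F t" for k
    using approximate_root[OF assms] by blast
  then obtain X where X: "\<And>k. p ^ Suc k dvd F (X k)"
    by metis
  have "p ^ k dvd X (Suc k) - X k" for k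
  proof -
    have "p ^ Suc k dvd F (X (Suc k))"
      using X[of "Suc k"] by (rule dvd_trans[rotated]) simp
    then have "p ^ Suc k dvd F (X (Suc k)) - F (X k)"
      using X by (rule dvd_diff)
    then show ?thesis
      by (simp only: F_cong_iff[OF assms])
  qed
  then obtain \<tau> where \<tau>: "\<And>k. p ^ k dvd X k - \<tau>"
    using padic_convergent by blast
  have "p ^ k dvd F \<tau>" for k
  proof -
    have "p ^ Suc k dvd F (X k) - (F (X k) - F \<tau>)"
      by (intro dvd_diff X F_cong \<tau>)
    then have "p ^ Suc k dvd F \<tau>"
      by simp
    then show ?thesis
      by (rule dvd_trans[rotated]) simp
  qed
  then show thesis
    using padic_eq_0I that by blast
qed

text \<open>This is the isometry property against \<tau>. Comparing lower bounds treats
  \<open>t = \<tau>\<close>, where both sides are infinite, together with the other points.\<close>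

lemma padic_val_F:
  assumes "\<not> p dvd \<delta>" "F \<tau> = 0"
  shows "padic_val (F t) = 1 + padic_val (t - \<tau>)"
proof -
  have "enat k \<le> padic_val (F t) \<longleftrightarrow> enat k \<le> 1 + padic_val (t - \<tau>)" for k
  proof (cases k)
    case (Suc j)
    have "enat k \<le> padic_val (F t) \<longleftrightarrow> p ^ j dvd t - \<tau>"
      using F_cong_iff[OF assms(1), of j t \<tau>] assms(2) by (simp add: padic_val_ge_iff Suc)
    also have "\<dots> \<longleftrightarrow> enat j \<le> padic_val (t - \<tau>)"
      by (simp only: padic_val_ge_iff)
    also have "\<dots> \<longleftrightarrow> enat k \<le> 1 + padic_val (t - \<tau>)"
      by (cases "padic_val (t - \<tau>)") (auto simp: Suc one_enat_def)
    finally show ?thesis .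
  qed (simp flip: zero_enat_def)
  then show ?thesis
    using enat_le_if_enat_le[of "padic_val (F t)" "1 + padic_val (t - \<tau>)"]
      enat_le_if_enat_le[of "1 + padic_val (t - \<tau>)" "padic_val (F t)"] by (simp add: antisym)
qed

text \<open>No zero is lost: by \<open>F_cong\<close>, a zero modulo the next power of
  \<open>p\<close> reduces to a zero at the previous stage. The start \<open>{0}\<close> is correct
  because \<open>p\<close> divides \<open>F 0\<close>.\<close>

lemma digit_recursion_eq:
  "digit_recursion F (Suc k) = {r \<in> {0..<int CARD('p) ^ k}. p ^ Suc k dvd F (of_int r)}"
proof (induction k)
  case 0
  then show ?case
    using p_dvd_F_0 by auto
next
  case (Suc k)
  let ?q = "int CARD('p)"
  have q: "?q > 0" "?q ^ k > 0"
    using padic_card_gt_1[where 'p = 'p] by simp_all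
  have "s \<in> digit_recursion F (Suc (Suc k))"
    if s: "0 \<le> s" "s < ?q ^ Suc k" "p ^ Suc (Suc k) dvd F (of_int s)" for s
  proof -
    \<comment> \<open>The top base-p digit of \<open>s\<close> is split off; the rest is its
      predecessor in the recursion.\<close>
    let ?r = "s mod ?q ^ k" and ?j = "s div ?q ^ k"
    have rj: "s = ?r + ?q ^ k * ?j"
      by simp
    have "p ^ k dvd of_int s - of_int ?r"
      by (simp add: padic_residue_of_int flip: padic_residue_eq_iff)
    then have "p ^ Suc k dvd F (of_int s) - F (of_int ?r)"
      by (rule F_cong)
    moreover have "p ^ Suc k dvd F (of_int s)"
      using s(3) by (rule dvd_trans[rotated]) simp
    ultimately have "p ^ Suc k dvd F (of_int s) - (F (of_int s) - F (of_int ?r))"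
      by (rule dvd_diff[rotated])
    then have "?r \<in> digit_recursion F (Suc k)"
      using q unfolding Suc by simp
    moreover have "?j \<in> {0..<?q}"
    proof -
      have "?q ^ k * ?j \<le> s"
        using rj q pos_mod_sign[of "?q ^ k" s] by linarith
      also have "s < ?q ^ k * ?q"
        using s(2) by (simp add: mult.commute)
      finally show ?thesis
        using s(1) q by (simp add: pos_imp_zdiv_nonneg_iff)
    qed
    moreover have "s = (?r + ?q ^ k * ?j) mod ?q ^ Suc k"
      using s rj by (metis mod_pos_pos_trivial)
    moreover have "p ^ Suc (Suc k) dvd F (of_int (?r + ?q ^ k * ?j))"
      using s(3) by (simp only: rj[symmetric])
    ultimately show ?thesis
      unfolding digit_recursion.simps mem_Collect_eq by blast
  qed
  moreover have "0 \<le> s \<and> s < ?q ^ Suc k \<and> p ^ Suc (Suc k) dvd F (of_int s)"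
    if s: "s \<in> digit_recursion F (Suc (Suc k))" for s
  proof -
    obtain r j where rj: "s = (r + ?q ^ k * j) mod ?q ^ Suc k" "r \<in> digit_recursion F (Suc k)"
        "j \<in> {0..<?q}" "p ^ Suc (Suc k) dvd F (of_int (r + ?q ^ k * j))"
      using s unfolding digit_recursion.simps mem_Collect_eq by blast
    have r: "0 \<le> r" "r < ?q ^ k"
      using rj(2) unfolding Suc by auto
    \<comment> \<open>The new representative is already below the modulus, so the reduction in the
      recursion changes nothing.\<close>
    have "?q ^ k * (j + 1) \<le> ?q ^ k * ?q"
      using rj(3) q by (intro mult_left_mono) auto
    then have *: "r + ?q ^ k * j < ?q ^ Suc k"
      using r by (simp add: algebra_simps)
    have "0 \<le> r + ?q ^ k * j"
      using r rj(3) q by simp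
    then show ?thesis
      using rj * by simp
  qed
  ultimately show ?case
    unfolding set_eq_iff mem_Collect_eq atLeastLessThan_iff by blast
qed

lemma digit_recursion_eq_residues:
  "digit_recursion F (Suc k) = {padic_residue t k | t. p ^ Suc k dvd F t}"
proof -
  have "p ^ Suc k dvd F (of_int (padic_residue t k)) \<longleftrightarrow> p ^ Suc k dvd F t" for t
  proof -
    have "p ^ Suc k dvd F t - F (of_int (padic_residue t k))"
      by (rule F_cong) (rule padic_dvd_diff_residue)
    then show ?thesis
      by (metis diff_add_cancel dvd_add_right_iff)
  qed
  moreover have "padic_residue (of_int r :: 'p padic_int) k = r" if "r \<in> {0..<int CARD('p) ^ k}" for r
    using that by (simp add: padic_residue_of_int)
  ultimately show ?thesis
    unfolding digit_recursion_eq using padic_residue_bounds by (blast intro: sym)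
qed

lemma F_div_p_cong: "p dvd F t div p - (F 0 div p + \<delta> * t)"
proof -
  obtain a where a: "F 0 = p * a"
    using p_dvd_F_0 ..
  obtain h where "F t - F 0 = p * ((t - 0) * (\<delta> + p * h))"
    by (rule difference_factor)
  then have "F t = p * (a + t * (\<delta> + p * h))"
    unfolding a by (simp add: algebra_simps)
  then have "F t div p = a + t * (\<delta> + p * h)" "F 0 div p = a"
    using padic_p_nonzero[where 'p = 'p] by (simp_all only: a nonzero_mult_div_cancel_left not_False_eq_True)
  then show ?thesis
    by (simp add: algebra_simps)
qed

end


section \<open>Trace sequences\<close>

text \<open>Each p-th power gains a factor \<open>p\<close>: in
  \<open>z ^ p - 1 = (z - 1) * (\<Sum>i<p. z ^ i)\<close> the second factor is congruent to
  \<open>p\<close>, hence to 0. This yields the period \<open>P * p ^ k\<close> of the powers of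
  \<eta> modulo \<open>p ^ (k + 1)\<close>.\<close>

lemma p_power_dvd_power_diff_1:
  fixes y :: "'a::comm_ring_1"
  assumes "of_nat p dvd y - 1"
  shows "of_nat p ^ Suc k dvd y ^ (p ^ k) - 1"
proof (induction k)
  case (Suc k)
  let ?z = "y ^ (p ^ k)"
  have "?z ^ p - 1 = (?z - 1) * (\<Sum>i<p. ?z ^ i)"
    by (rule power_diff_1_eq)
  moreover have "of_nat p dvd (\<Sum>i<p. ?z ^ i)"
  proof -
    have z: "of_nat p dvd ?z - 1"
      using Suc by (rule dvd_trans[rotated]) simp
    have "of_nat p dvd ?z ^ i - 1" for i
      using z power_diff_1_eq[of ?z i] by (metis dvd_mult2)
    then have "of_nat p dvd (\<Sum>i<p. ?z ^ i - 1) + of_nat p"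
      by (intro dvd_add dvd_sum) auto
    then show ?thesis
      by (simp add: sum_subtractf)
  qed
  ultimately have "of_nat p ^ Suc k * of_nat p dvd ?z ^ p - 1"
    using Suc by (simp only: mult_dvd_mono)
  then show ?case
    by (simp add: mult.commute flip: power_mult)
qed (use assms in simp)

lemma dvd_power_diff_power_mod:
  fixes y :: "'a::comm_ring_1"
  assumes "D dvd y ^ N - 1"
  shows "D dvd y ^ n - y ^ (n mod N)"
proof -
  have "y ^ n - y ^ (n mod N) = y ^ (n mod N) * ((y ^ N) ^ (n div N) - 1)"
    by (simp add: right_diff_distrib flip: power_mult power_add)
  also have "D dvd \<dots>"
    using assms by (metis dvd_mult dvd_mult2 power_diff_1_eq)
  finally show ?thesis .
qed

lemma unit_powi_cong:
  fixes \<eta> :: "'a::comm_ring_1"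
  assumes \<eta>: "\<eta> dvd 1" and N: "D dvd \<eta> ^ N - 1" "N > 0"
  shows "D dvd unit_powi \<eta> n - \<eta> ^ nat (n mod int N)"
proof (cases "0 \<le> n")
  case True
  then have "nat (n mod int N) = nat n mod N"
    by (simp add: nat_mod_distrib)
  then show ?thesis
    using True dvd_power_diff_power_mod[OF N(1)] by (simp add: unit_powi_def)
next
  case False
  define j where "j = nat (- n)"
  have n: "n = - int j"
    using False by (simp add: j_def)
  obtain y where y: "\<eta> * y = 1"
    using \<eta> by (metis dvdE)
  have "(THE y. \<eta> * y = 1) = y"
  proof (rule the_equality)
    show "z = y" if "\<eta> * z = 1" for z
      using that y by (metis mult.commute mult.left_commute mult_1_right)
  qed (rule y)
  then have powi: "unit_powi \<eta> n = y ^ j"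
    using False by (simp add: unit_powi_def j_def)
  \<comment> \<open>A nonnegative exponent congruent to \<open>- j\<close> modulo \<open>N\<close>,
    through which the inverse power is compared with a natural power.\<close>
  let ?m = "(N - 1) * j"
  have "\<eta> ^ (N * j) = \<eta> ^ ?m * \<eta> ^ j"
    using N(2) by (cases N) (simp_all add: power_add mult.commute)
  then have "y ^ j * \<eta> ^ (N * j) = \<eta> ^ ?m * (\<eta> * y) ^ j"
    by (simp add: power_mult_distrib mult_ac)
  then have *: "y ^ j * \<eta> ^ (N * j) = \<eta> ^ ?m"
    by (simp add: y)
  have "D dvd y ^ j * (\<eta> ^ (N * j) - 1)"
    using N(1) dvd_power_diff_power_mod[OF N(1), of "N * j"] by (intro dvd_mult) simp
  then have 1: "D dvd \<eta> ^ ?m - y ^ j"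
    by (simp add: right_diff_distrib *)
  have "int ?m mod int N = n mod int N"
  proof -
    have "int ?m = n + int N * int j"
      using N(2) by (simp add: n of_nat_diff algebra_simps)
    then show ?thesis
      by simp
  qed
  then have "nat (n mod int N) = ?m mod N"
    by (metis nat_int zmod_int)
  then have 2: "D dvd \<eta> ^ ?m - \<eta> ^ nat (n mod int N)"
    using dvd_power_diff_power_mod[OF N(1)] by simp
  show ?thesis
    using dvd_diff[OF 2 1] by (simp add: powi)
qed

lemma residues_mod_eq:
  assumes "(N :: int) > 0"
  shows "{n mod N | n. Q (n mod N)} = {n \<in> {0..<N}. Q n}"
proof (intro subset_antisym subsetI)
  fix m assume "m \<in> {n \<in> {0..<N}. Q n}"
  then show "m \<in> {n mod N | n. Q (n mod N)}"
    by (intro CollectI exI[of _ m]) auto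
qed (use assms in auto)

lemma restricted_series_divide_p:
  fixes f :: "'p::prime_card padic_int fps"
  assumes f: "f \<in> restricted_series" and dvd: "\<And>n. of_nat CARD('p) dvd fps_nth f n"
  shows "\<exists>g\<in>restricted_series. f = fps_const (of_nat CARD('p)) * g"
proof -
  let ?p = "of_nat CARD('p) :: 'p padic_int"
  have "\<exists>h. fps_nth f n = ?p * h" for n
    using dvd unfolding dvd_def .
  then obtain h where h: "\<And>n. fps_nth f n = ?p * h n"
    by metis
  have "\<exists>N. \<forall>n\<ge>N. ?p ^ k dvd h n" for k
  proof -
    obtain N where "\<forall>n\<ge>N. ?p ^ Suc k dvd fps_nth f n"
      using f unfolding restricted_series_def by blast
    then have "\<forall>n\<ge>N. ?p ^ k dvd h n"
      using padic_p_nonzero[where 'p = 'p] by (simp add: h)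
    then show ?thesis ..
  qed
  then have "Abs_fps h \<in> restricted_series"
    by (simp add: restricted_series_def)
  moreover have "f = fps_const ?p * Abs_fps h"
    by (rule fps_ext) (simp add: h)
  ultimately show ?thesis ..
qed

context free_padic_algebra
begin

text \<open>Periodicity shows that the condition does not depend on the integer representing a
  class, so it may be tested on the canonical one.\<close>

lemma trace_zeros_eq:
  assumes \<eta>: "\<eta> dvd 1" and P: "0 < P" and U: "\<eta> ^ P = 1 + of_nat CARD('p) * U"
  shows "trace_zeros scale \<gamma> \<eta> c P (Suc k) = {n \<in> {0..<int P * int CARD('p) ^ k}.
    of_nat CARD('p) ^ Suc k dvd algebra_trace scale (\<gamma> * \<eta> ^ nat n) - c}"
proof -
  let ?N = "P * CARD('p) ^ k" and ?T = "\<lambda>y. algebra_trace scale (\<gamma> * y) - c"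
  have N: "?N > 0"
    using P by simp
  have "of_nat CARD('p) ^ Suc k dvd \<eta> ^ ?N - 1"
    unfolding power_mult by (rule p_power_dvd_power_diff_1) (simp add: U)
  then have cong: "of_nat CARD('p) ^ Suc k dvd unit_powi \<eta> n - \<eta> ^ nat (n mod int ?N)" for n
    using \<eta> N by (intro unit_powi_cong)
  have iff: "of_nat CARD('p) ^ Suc k dvd ?T (unit_powi \<eta> n) \<longleftrightarrow>
      of_nat CARD('p) ^ Suc k dvd ?T (\<eta> ^ nat (n mod int ?N))" for n
  proof -
    have "of_nat CARD('p) ^ Suc k dvd algebra_trace scale (\<gamma> * (unit_powi \<eta> n - \<eta> ^ nat (n mod int ?N)))"
      by (intro p_power_dvd_trace dvd_mult cong)
    then have "of_nat CARD('p) ^ Suc k dvd ?T (unit_powi \<eta> n) - ?T (\<eta> ^ nat (n mod int ?N))"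
      by (simp add: right_diff_distrib algebra_trace_diff)
    then show ?thesis
      by (metis diff_add_cancel dvd_add_right_iff)
  qed
  have "trace_zeros scale \<gamma> \<eta> c P (Suc k)
      = {n mod int ?N | n. of_nat CARD('p) ^ Suc k dvd ?T (\<eta> ^ nat (n mod int ?N))}"
    unfolding trace_zeros_def iff by simp
  also have "\<dots> = {n \<in> {0..<int ?N}. of_nat CARD('p) ^ Suc k dvd ?T (\<eta> ^ nat n)}"
    using N by (intro residues_mod_eq) simp
  finally show ?thesis
    by simp
qed

lemma trace_power_series:
  fixes \<gamma> u v :: 'a and c :: "'p padic_int"
  assumes p: "5 \<le> CARD('p)" and u: "u = 1 + of_nat CARD('p) * v"
  defines "F \<equiv> \<lambda>t. algebra_trace scale (\<gamma> * binomial_power scale u t) - c"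
  obtains f where "f \<in> restricted_series" "represents_function f F"
    "of_nat CARD('p) ^ 2 dvd fps_nth f 0 - (algebra_trace scale \<gamma> - c)"
    "of_nat CARD('p) ^ 2 dvd fps_nth f 1 - of_nat CARD('p) * algebra_trace scale (\<gamma> * v)"
    "\<And>n. 2 \<le> n \<Longrightarrow> of_nat CARD('p) ^ 2 dvd fps_nth f n"
proof -
  let ?p = "of_nat CARD('p) :: 'p padic_int"
  \<comment> \<open>The witness is the integral form of \<open>p ^ m / m!\<close>: part of the power
    pays for the factorial, the rest remains as a divisor.\<close>
  have "\<exists>q. ?p ^ m = fact m * q \<and> ?p ^ (m - m div 4) dvd q" for m
  proof -
    obtain q where q: "?p ^ (m div 4) = fact m * q"
      using padic_fact_dvd_power[OF p, of m] by (elim dvdE)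
    have "?p ^ m = ?p ^ (m div 4) * ?p ^ (m - m div 4)"
      by (simp flip: power_add)
    then have "?p ^ m = fact m * (q * ?p ^ (m - m div 4))"
      by (simp add: q mult.assoc)
    then show ?thesis
      by (intro exI[of _ "q * ?p ^ (m - m div 4)"]) simp
  qed
  then obtain q where q: "\<And>m. ?p ^ m = fact m * q m" "\<And>m. ?p ^ (m - m div 4) dvd q m"
    by metis
  \<comment> \<open>The constant c is absorbed into the term m = 0, whose falling factorial is 1.
    The partial sums therefore match those of the trace series only from n = 1 on, which explains
    \<open>Suc (N k)\<close> below.\<close>
  define e where "e m = q m * algebra_trace scale (\<gamma> * v ^ m) - (if m = 0 then c else 0)" for m
  have e: "?p ^ (m - m div 4) dvd e m" for m
    using q(2)[of m] by (cases m) (simp_all add: e_def)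
  have term_eq: "algebra_trace scale (\<gamma> * scale (padic_binomial t m) ((u - 1) ^ m)) - (if m = 0 then c else 0)
      = poly (falling_poly m) t * e m" for t m
  proof -
    have "\<gamma> * scale (padic_binomial t m) ((u - 1) ^ m)
        = scale (padic_binomial t m * ?p ^ m) (\<gamma> * v ^ m)"
      by (simp add: u power_mult_distrib p_power_mult_eq_scale scale_mult_right)
    then have "algebra_trace scale (\<gamma> * scale (padic_binomial t m) ((u - 1) ^ m))
        = (fact m * padic_binomial t m) * (q m * algebra_trace scale (\<gamma> * v ^ m))"
      by (simp add: algebra_trace_scale q(1) mult_ac)
    then show ?thesis
      unfolding fact_mult_padic_binomial poly_falling_poly by (cases m) (simp_all add: e_def)
  qed
  have "padic_sums CARD('p) (\<lambda>m. poly (falling_poly m) t * e m) (F t)" for t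
  proof -
    have *: "(\<Sum>m<n. poly (falling_poly m) t * e m)
        = (\<Sum>m<n. algebra_trace scale (\<gamma> * scale (padic_binomial t m) ((u - 1) ^ m))) - c"
      if "n \<ge> 1" for n
      using that by (simp flip: term_eq add: sum_subtractf)
    have "padic_sums CARD('p) (\<lambda>m. algebra_trace scale (\<gamma> * scale (padic_binomial t m) ((u - 1) ^ m)))
        (algebra_trace scale (\<gamma> * binomial_power scale u t))"
      by (intro padic_sums_trace padic_sums_binomial_power[OF u])
    then have "\<exists>N. \<forall>n\<ge>N. ?p ^ k dvd
        (\<Sum>m<n. algebra_trace scale (\<gamma> * scale (padic_binomial t m) ((u - 1) ^ m)))
        - algebra_trace scale (\<gamma> * binomial_power scale u t)" for k
      unfolding padic_sums_def by blast
    then obtain N where N: "\<And>k n. n \<ge> N k \<Longrightarrow> ?p ^ k dvd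
        (\<Sum>m<n. algebra_trace scale (\<gamma> * scale (padic_binomial t m) ((u - 1) ^ m)))
        - algebra_trace scale (\<gamma> * binomial_power scale u t)"
      by metis
    have "?p ^ k dvd (\<Sum>m<n. poly (falling_poly m) t * e m) - F t" if "n \<ge> Suc (N k)" for k n
      using N[of k n] that by (simp add: * F_def)
    then show ?thesis
      unfolding padic_sums_def by blast
  qed
  with e obtain f where f: "f \<in> restricted_series" "represents_function f F"
    "\<And>n. ?p ^ 2 dvd fps_nth f n - (if n = 0 then e 0 else if n = 1 then e 1 else 0)"
    by (rule falling_series_power_series) blast
  have "q 0 = 1" "q 1 = ?p"
    using q(1)[of 0] q(1)[of 1] by simp_all
  then have "e 0 = algebra_trace scale \<gamma> - c" "e 1 = ?p * algebra_trace scale (\<gamma> * v)"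
    by (simp_all add: e_def)
  moreover have "?p ^ 2 dvd fps_nth f n" if "2 \<le> n" for n
    using f(3)[of n] that by simp
  ultimately show thesis
    using f(3)[of 0] f(3)[of 1] by (intro that[OF f(1,2)]) simp_all
qed

end

text \<open>Unique representation gives meaning to \<open>F a\<close> as a restricted series, and
  hence to its divisibility by \<open>p\<close>. The last clause ties the recursion to the lifts
  themselves through \<open>n = a + P * r\<close>.\<close>

theorem theorem3p4:
  fixes scale :: "'p::prime_card padic_int \<Rightarrow> 'a::comm_ring_1 \<Rightarrow> 'a"
    and \<eta> \<gamma> U :: 'a
    and c :: "'p padic_int"
    and p P :: nat
    and Tr :: "'a \<Rightarrow> 'p padic_int"
    and Tr_bar :: "('a, 'p) mod_p \<Rightarrow> 'p mod_ring"
    and \<omega> :: "('a, 'p) mod_p"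
    and x :: "nat \<Rightarrow> ('a, 'p) mod_p"
    and d :: "nat \<Rightarrow> 'p mod_ring"
    and F :: "nat \<Rightarrow> 'p padic_int \<Rightarrow> 'p padic_int"
    and Z :: "nat \<Rightarrow> int set"
  assumes p: "p = CARD('p)" "5 \<le> p"
    and A: "finite_etale_algebra scale 3"
    and Tr: "Tr = algebra_trace scale"
    and Tr_bar: "Tr_bar = algebra_trace Fp_scale"
    and \<eta>: "\<eta> dvd 1"
    and P: "P = mult_order (to_mod_p \<eta> :: ('a, 'p) mod_p)"
    and U: "\<eta> ^ P = 1 + of_nat p * U"
    and \<omega>: "\<omega> = to_mod_p U"
    and x: "\<And>a. x a = to_mod_p \<gamma> * to_mod_p \<eta> ^ a"
    and d: "\<And>a. d a = Tr_bar (x a * \<omega>)"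
    and F: "\<And>a t. F a t = Tr (\<gamma> * \<eta> ^ a * binomial_power scale (\<eta> ^ P) t) - c"
    and Z: "\<And>k. Z k = trace_zeros scale \<gamma> \<eta> c P k"
  shows "Z 1 = int ` {a. a < P \<and> Tr_bar (x a) = padic_to_Fp c} \<and>
    (\<forall>a<P. int a \<in> Z 1 \<longrightarrow>
      (\<exists>!f. f \<in> restricted_series \<and> represents_function f (F a)) \<and>
      (\<forall>f. f \<in> restricted_series \<and> represents_function f (F a) \<longrightarrow>
        (\<exists>g\<in>restricted_series. f = fps_const (of_nat p) * g)) \<and>
      (\<forall>t. padic_to_Fp (F a t div of_nat p) =
        padic_to_Fp ((Tr (\<gamma> * \<eta> ^ a) - c) div of_nat p) + padic_to_Fp t * d a) \<and>
      (d a \<noteq> 0 \<longrightarrow>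
        (\<exists>\<tau>. F a \<tau> = 0 \<and> (\<forall>\<sigma>. F a \<sigma> = 0 \<longrightarrow> \<sigma> = \<tau>) \<and>
          (\<forall>t. padic_val (F a t) = 1 + padic_val (t - \<tau>)))) \<and>
      (d a = 0 \<longrightarrow>
        ((\<exists>n\<in>Z 2. n mod int P = int a) \<longleftrightarrow>
          padic_to_Fp ((Tr (\<gamma> * \<eta> ^ a) - c) div of_nat p) = 0)) \<and>
      (\<forall>k\<ge>1.
        digit_recursion (F a) k =
          {padic_residue t (k - 1) | t. of_nat p ^ k dvd F a t} \<and>
        {n \<in> Z k. n mod int P = int a} = (\<lambda>r. int a + int P * r) ` digit_recursion (F a) k))"
proof -
  let ?p = "of_nat CARD('p) :: 'p padic_int"
  obtain B where "comm_algebra scale" "is_module_basis scale B"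
    using A unfolding finite_etale_algebra_def by blast
  then interpret A: free_padic_algebra scale B
    by (intro free_padic_algebra.intro free_comm_algebra.intro free_comm_algebra_axioms.intro)
  have P0: "P > 0"
    unfolding P using \<eta> by (rule A.mult_order_red_pos)
  have U': "\<eta> ^ P = 1 + of_nat CARD('p) * U"
    using U p(1) by simp
  have p5: "5 \<le> CARD('p)"
    using p by simp
  have Z_Suc: "Z (Suc k) = {n \<in> {0..<int P * int CARD('p) ^ k}. ?p ^ Suc k dvd Tr (\<gamma> * \<eta> ^ nat n) - c}" for k
    unfolding Z Tr by (rule A.trace_zeros_eq[OF \<eta> P0 U'])
  have Tr_bar_red: "Tr_bar (to_mod_p y) = padic_to_Fp (Tr y)" for y
    unfolding Tr Tr_bar by (rule A.trace_red)
  have x_red: "x a = to_mod_p (\<gamma> * \<eta> ^ a)" for a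
    by (simp add: x to_mod_p_mult to_mod_p_power)
  have mem_Z1: "int a \<in> Z 1 \<longleftrightarrow> a < P \<and> Tr_bar (x a) = padic_to_Fp c" for a
    using Z_Suc[of 0] by (auto simp: x_red Tr_bar_red padic_to_Fp_eq_iff)
  have F_of_nat: "F a (of_nat r) = Tr (\<gamma> * \<eta> ^ (a + P * r)) - c" for a r
    by (simp add: F A.binomial_power_of_nat[OF U'] power_add power_mult mult.assoc)
  show ?thesis
  proof (intro conjI allI impI)
    show "Z 1 = int ` {a. a < P \<and> Tr_bar (x a) = padic_to_Fp c}"
    proof -
      have "n \<ge> 0" if "n \<in> Z 1" for n
        using that Z_Suc[of 0] by simp
      then have "\<exists>a. n = int a" if "n \<in> Z 1" for n
        using that nonneg_int_cases by metis
      then show ?thesis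
        using mem_Z1 by blast
    qed
  next
    fix a assume a: "a < P" "int a \<in> Z 1"
    define \<delta> where "\<delta> = Tr (\<gamma> * \<eta> ^ a * U)"
    have d_a: "d a = padic_to_Fp \<delta>"
      by (simp add: d x_red \<omega> \<delta>_def Tr_bar_red flip: to_mod_p_mult)
    have F_a: "F a = (\<lambda>t. algebra_trace scale (\<gamma> * \<eta> ^ a * binomial_power scale (\<eta> ^ P) t) - c)"
      by (simp add: F Tr fun_eq_iff)
    obtain f where f: "f \<in> restricted_series" "represents_function f (F a)"
      and f0: "?p ^ 2 dvd fps_nth f 0 - (Tr (\<gamma> * \<eta> ^ a) - c)"
      and f1: "?p ^ 2 dvd fps_nth f 1 - ?p * \<delta>"
      and f2: "\<And>n. 2 \<le> n \<Longrightarrow> ?p ^ 2 dvd fps_nth f n"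
      unfolding F_a \<delta>_def Tr by (rule A.trace_power_series[OF p5 U', of "\<gamma> * \<eta> ^ a" c]) blast
    have F_0: "F a 0 = Tr (\<gamma> * \<eta> ^ a) - c"
      using F_of_nat[of a 0] by simp
    \<comment> \<open>Membership of a in \<open>Z 1\<close> is exactly the integrality condition at
      0; the expansion is the power series difference with \<open>D = p ^ 2\<close> and slope
      \<open>p * \<delta>\<close>.\<close>
    interpret F: padic_affine_mod_p "F a" \<delta>
    proof
      show "?p ^ 2 * (t - s) dvd F a t - F a s - ?p * \<delta> * (t - s)" for t s
        using f(2) f1 f2 by (rule power_series_difference) simp_all
      show "?p dvd F a 0"
        using a mem_Z1[of a] by (simp add: F_0 x_red Tr_bar_red padic_to_Fp_eq_iff)
    qed
    have unique: "f' = f" if "represents_function f' (F a)" for f'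
      using that f(2) by (rule represents_function_unique)
    show "\<exists>!f. f \<in> restricted_series \<and> represents_function f (F a)"
      using f unique by blast
    show "\<exists>g\<in>restricted_series. f' = fps_const (of_nat p) * g"
      if "f' \<in> restricted_series \<and> represents_function f' (F a)" for f'
    proof -
      have p2: "?p dvd ?p ^ 2"
        by simp
      have "?p dvd fps_nth f n" for n
      proof -
        consider "n = 0" | "n = 1" | "n \<ge> 2"
          by linarith
        then show ?thesis
        proof cases
          case 1
          have "?p dvd (fps_nth f 0 - (Tr (\<gamma> * \<eta> ^ a) - c)) + (Tr (\<gamma> * \<eta> ^ a) - c)"
            using dvd_trans[OF p2 f0] F.p_dvd_F_0 unfolding F_0 by (rule dvd_add)
          then show ?thesis
            using 1 by simp
        next
          case 2
          have "?p dvd (fps_nth f 1 - ?p * \<delta>) + ?p * \<delta>"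
            using dvd_trans[OF p2 f1] by (rule dvd_add) simp
          then show ?thesis
            using 2 by simp
        next
          case 3
          then show ?thesis
            using dvd_trans[OF p2 f2] by blast
        qed
      qed
      then show ?thesis
        using restricted_series_divide_p[OF f(1)] unique that p(1) by blast
    qed
    have cong: "padic_to_Fp (F a t div of_nat p)
        = padic_to_Fp ((Tr (\<gamma> * \<eta> ^ a) - c) div of_nat p) + padic_to_Fp t * d a" for t
    proof -
      have "padic_to_Fp (F a t div ?p) = padic_to_Fp (F a 0 div ?p + \<delta> * t)"
        using F.F_div_p_cong by (simp only: padic_to_Fp_eq_iff)
      then show ?thesis
        by (simp add: padic_to_Fp_add padic_to_Fp_mult d_a F_0 p(1) mult.commute)
    qed
    then show "padic_to_Fp (F a t div of_nat p)
        = padic_to_Fp ((Tr (\<gamma> * \<eta> ^ a) - c) div of_nat p) + padic_to_Fp t * d a" for t .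
    show "\<exists>\<tau>. F a \<tau> = 0 \<and> (\<forall>\<sigma>. F a \<sigma> = 0 \<longrightarrow> \<sigma> = \<tau>) \<and>
        (\<forall>t. padic_val (F a t) = 1 + padic_val (t - \<tau>))" if "d a \<noteq> 0"
    proof -
      have \<delta>: "\<not> ?p dvd \<delta>"
        using that by (simp add: d_a padic_to_Fp_eq_0_iff)
      obtain \<tau> where \<tau>: "F a \<tau> = 0"
        using F.root[OF \<delta>] .
      have "\<sigma> = \<tau>" if "F a \<sigma> = 0" for \<sigma>
      proof -
        \<comment> \<open>Two zeros have equal values, so the isometry property makes them agree to
          every precision.\<close>
        have "?p ^ k dvd \<sigma> - \<tau>" for k
          using F.F_cong_iff[OF \<delta>, of k \<sigma> \<tau>] that \<tau> by simp
        then have "\<sigma> - \<tau> = 0"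
          by (rule padic_eq_0I)
        then show ?thesis
          by simp
      qed
      then show ?thesis
        using \<tau> F.padic_val_F[OF \<delta> \<tau>] by blast
    qed
    have lifts: "{n \<in> Z (Suc k). n mod int P = int a}
        = (\<lambda>r. int a + int P * r) ` digit_recursion (F a) (Suc k)" for k
    proof -
      let ?q = "int CARD('p) ^ k"
      have F_int: "F a (of_int r) = Tr (\<gamma> * \<eta> ^ nat (int a + int P * r)) - c" if "0 \<le> r" for r
        using F_of_nat[of a "nat r"] that by (simp add: nat_add_distrib nat_mult_distrib)
      have "int a + int P * r \<in> Z (Suc k) \<and> (int a + int P * r) mod int P = int a"
        if r: "r \<in> digit_recursion (F a) (Suc k)" for r
      proof -
        have r: "0 \<le> r" "r < ?q" "?p ^ Suc k dvd F a (of_int r)"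
          using r unfolding F.digit_recursion_eq by auto
        have "int P * (r + 1) \<le> int P * ?q"
          using r by (intro mult_left_mono) auto
        then have "int a + int P * r < int P * ?q"
          using a(1) by (simp add: algebra_simps)
        then show ?thesis
          using r a(1) by (simp add: Z_Suc F_int)
      qed
      moreover have "n \<in> (\<lambda>r. int a + int P * r) ` digit_recursion (F a) (Suc k)"
        if n: "n \<in> Z (Suc k)" "n mod int P = int a" for n
      proof
        let ?r = "n div int P"
        show eq: "n = int a + int P * ?r"
          using n(2) by (metis mod_mult_div_eq)
        have n': "0 \<le> n" "n < int P * ?q" "?p ^ Suc k dvd Tr (\<gamma> * \<eta> ^ nat n) - c"
          using n(1) unfolding Z_Suc by auto
        have r0: "0 \<le> ?r"
          using n'(1) P0 by (simp add: pos_imp_zdiv_nonneg_iff)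
        have "int P * ?r < int P * ?q"
          using eq n'(2) by linarith
        then have "?r < ?q"
          using P0 by simp
        moreover have "?p ^ Suc k dvd F a (of_int ?r)"
          using n'(3) unfolding F_int[OF r0] eq[symmetric] .
        ultimately show "?r \<in> digit_recursion (F a) (Suc k)"
          using r0 unfolding F.digit_recursion_eq by simp
      qed
      ultimately show ?thesis
        by blast
    qed
    show "(\<exists>n\<in>Z 2. n mod int P = int a) \<longleftrightarrow>
        padic_to_Fp ((Tr (\<gamma> * \<eta> ^ a) - c) div of_nat p) = 0" if "d a = 0"
    proof -
      \<comment> \<open>With slope zero, \<open>F a t / p\<close> is constant modulo
        \<open>p\<close>: either every t gives a zero modulo \<open>p ^ 2\<close> or none
        does.\<close>
      have "?p ^ 2 dvd F a t \<longleftrightarrow> padic_to_Fp ((Tr (\<gamma> * \<eta> ^ a) - c) div of_nat p) = 0" for t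
      proof -
        obtain h where h: "F a t = ?p * h"
          using F.p_dvd_F[of t] by (elim dvdE)
        then have "F a t div ?p = h"
          by simp
        then have "padic_to_Fp ((Tr (\<gamma> * \<eta> ^ a) - c) div of_nat p) = padic_to_Fp h"
          using cong[of t] \<open>d a = 0\<close> p(1) by simp
        then show ?thesis
          by (simp add: h power2_eq_square padic_to_Fp_eq_0_iff)
      qed
      moreover have "(\<exists>n\<in>Z 2. n mod int P = int a) \<longleftrightarrow> (\<exists>t. ?p ^ 2 dvd F a t)"
        using lifts[of 1] F.digit_recursion_eq_residues[of 1] by (auto simp: numeral_2_eq_2)
      ultimately show ?thesis
        by simp
    qed
    fix k :: nat assume "1 \<le> k"
    then obtain j where k: "k = Suc j"
      by (cases k) auto
    show "digit_recursion (F a) k = {padic_residue t (k - 1) | t. of_nat p ^ k dvd F a t}"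
      unfolding k p(1) F.digit_recursion_eq_residues by simp
    show "{n \<in> Z k. n mod int P = int a} = (\<lambda>r. int a + int P * r) ` digit_recursion (F a) k"
      unfolding k by (rule lifts)
  qed
qed

end
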